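(* Let $p$ be an odd prime, $q=p^e$, and let $k\ge 3$ be coprime to $p$ with $(k,k)$ hyperbolic, i.e. $1/k+1/k<1/2$. Let $l=k$, let $\xi_\kappa,\xi_\lambda$ be primitive $2k$-th and $2l$-th roots of unity in $GF(q)$ or $GF(q^2)$, and let $\omega_\kappa=\xi_\kappa+\xi_\kappa^{-1}$, $\omega_\lambda=\xi_\lambda+\xi_\lambda^{-1}$. Consider the regular map of type $(k,k)$ given by the generating triple $(X,Y,Z)$ of matrices determined by $\xi_\kappa,\xi_\lambda$ described in the context, where $G=\langle X,Y,Z\rangle$ is isomorphic to $PSL(2,q)$ or $PGL(2,q)$. Then the map is self-dual if and only if there is an integer $j$ with $j=0$ or $2j=e$ such that, with $r=p^j$, $\omega_\lambda=\omega_\kappa^r$ or $\omega_\lambda=-\omega_\kappa^r$.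
   Context: A regular map of type $(k,l)$ (vertex degree $k$, face length $l$) is identified with a group $G$ generated by three involutions $X,Y,Z$ such that $XY$, $YZ$, $ZX$ have orders exactly $2,k,l$ respectively. The map is self-dual if $G$ has an (involutory) automorphism fixing $Z$ and interchanging $X$ and $Y$. Matrices are regarded up to nonzero scalar multiples, i.e. as elements of $PGL(2,K)$ with $K$ an algebraic closure of $GF(p)$. For $k,l$ coprime to $p$, put $D=\omega_\kappa^2+\omega_\lambda^2-4$ (assumed nonzero), $\beta=-1/\sqrt{-D}$, $\eta=(\xi_\kappa-\xi_\kappa^{-1})^{-1}$. The generating triple is $$X=\eta\beta\begin{pmatrix} D & D\omega_\lambda\xi_\kappa\\ -\omega_\lambda\xi_\kappa^{-1} & -D\end{pmatrix},\quad Y=\beta\begin{pmatrix}0&\xi_\kappa D\\ \xi_\kappa^{-1}&0\end{pmatrix},\quad Z=\beta\begin{pmatrix}0&D\\1&0\end{pmatrix}.$$ *)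

theory Defs
  imports
    "HOL-Algebra.Multiplicative_Group"
    "HOL-Algebra.Generated_Groups"
    "HOL-Analysis.Analysis"
begin

subsection \<open>Algebraic closure of a prime field\<close>

text \<open>The prime field inside \<open>'a\<close> is the image of the integers, so algebraicity over it is
  expressed with integer polynomials that do not vanish in \<open>'a\<close>. Algebraic closedness itself
  comes from the type class.\<close>

definition algebraic_closure_of_GF :: "'a::alg_closed_field itself \<Rightarrow> nat \<Rightarrow> bool" where
  "algebraic_closure_of_GF T p \<longleftrightarrow>
     CHAR('a) = p \<and>
     (\<forall>x::'a. \<exists>f::int poly. map_poly of_int f \<noteq> (0 :: 'a poly) \<and> poly (map_poly of_int f) x = 0)"

text \<open>The subfield of order \<open>q\<close>; meaningful when \<open>q\<close> is a power of the characteristic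
  (\<open>GF_subfield\<close> and \<open>card_GF\<close> below).\<close>

definition GF :: "nat \<Rightarrow> 'a::alg_closed_field set" where
  "GF q = {x. x ^ q = x}"

lemma GF_subfield:
  assumes "prime CHAR('a::alg_closed_field)" and "q = CHAR('a) ^ e"
  shows "(0::'a) \<in> GF q" "(1::'a) \<in> GF q"
    and "\<And>x y::'a. x \<in> GF q \<Longrightarrow> y \<in> GF q \<Longrightarrow> x - y \<in> GF q"
    and "\<And>x y::'a. x \<in> GF q \<Longrightarrow> y \<in> GF q \<Longrightarrow> x * y \<in> GF q"
    and "\<And>x::'a. x \<in> GF q \<Longrightarrow> inverse x \<in> GF q"
proof -
  have q0: "q > 0" using assms by (simp add: prime_gt_0_nat)
  then show "(0::'a) \<in> GF q" "(1::'a) \<in> GF q" by (simp_all add: GF_def)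
  show "x * y \<in> GF q" if "x \<in> GF q" "y \<in> GF q" for x y :: 'a
    using that by (simp add: GF_def power_mult_distrib)
  show "inverse x \<in> GF q" if "x \<in> GF q" for x :: 'a
    using that by (simp add: GF_def power_inverse)
  show "x - y \<in> GF q" if "x \<in> GF q" "y \<in> GF q" for x y :: 'a
  proof -
    have "x ^ q = ((x - y) + y) ^ q" by simp
    also have "\<dots> = (x - y) ^ q + y ^ q"
      using assms by (intro freshmans_dream') auto
    finally show ?thesis using that by (simp add: GF_def algebra_simps)
  qed
qed

lemma card_GF:
  assumes "prime CHAR('a::alg_closed_field)" and "q = CHAR('a) ^ e" and "e > 0"
  shows "card (GF q :: 'a set) = q"
proof -
  have "CHAR('a) > 1" using assms(1) prime_gt_1_nat by blast
  then have q1: "q > 1" using assms(2,3) by (metis one_less_power)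
  have q0: "of_nat q = (0::'a)"
    unfolding of_nat_eq_0_iff_char_dvd using assms(2,3) by simp
  define P :: "'a poly" where "P = monom 1 q - [:0, 1:]"
  have P': "pderiv P = - 1"
    by (simp add: P_def pderiv_diff pderiv_monom q0 pderiv_pCons one_pCons)
  have degP: "degree P = q"
    unfolding P_def diff_conv_add_uminus
    by (subst degree_add_eq_left) (use q1 in \<open>simp_all add: degree_monom_eq\<close>)
  have lead: "lead_coeff P = 1"
    unfolding degP using q1 by (simp add: P_def coeff_pCons split: nat.split)
  have "P \<noteq> 0" using lead by auto
  then obtain A where A: "size A = q" "P = (\<Prod>x\<in>#A. [:-x, 1:])"
    using alg_closed_imp_factorization[of P] degP lead by auto
  have "count A x \<le> 1" for x
  proof (rule ccontr)
    assume "\<not> count A x \<le> 1"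
    then have "replicate_mset 2 x \<subseteq># A" by (simp flip: count_le_replicate_mset_subset_eq)
    then obtain B where "A = replicate_mset 2 x + B" by (metis subset_mset.le_iff_add)
    then have "P = [:-x, 1:] * ([:-x, 1:] * (\<Prod>y\<in>#B. [:-y, 1:]))"
      unfolding A(2) by (simp add: numeral_2_eq_2 mult.assoc)
    then have "poly (pderiv P) x = 0"
      by (simp only: pderiv_mult poly_add poly_mult) simp
    then show False by (simp add: P')
  qed
  then have "A = mset_set (set_mset A)"
    by (intro multiset_eqI) (metis count_mset_set(1,3) count_eq_zero_iff finite_set_mset
        le_less less_one)
  then have "size A = card (set_mset A)" by (metis size_mset_set)
  moreover have "set_mset A = GF q"
  proof -
    have "x \<in># A \<longleftrightarrow> poly P x = 0" for x
      unfolding A(2) by (auto simp: poly_prod_mset prod_mset_zero_iff)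
    then show ?thesis by (auto simp: P_def GF_def poly_monom)
  qed
  ultimately show ?thesis using A(1) by simp
qed


subsection \<open>Two-dimensional linear groups over a subfield\<close>

text \<open>Here \<open>F\<close> is the underlying set of a subfield of \<open>'a\<close>; the scalar matrix with entry
  \<open>c\<close> is \<open>mat c\<close>.\<close>

definition GL2 :: "'a::field set \<Rightarrow> ('a^2^2) monoid" where
  "GL2 F = \<lparr>carrier = {A. (\<forall>i j. A $ i $ j \<in> F) \<and> det A \<noteq> 0}, monoid.mult = (**), monoid.one = mat 1\<rparr>"

definition SL2 :: "'a::field set \<Rightarrow> ('a^2^2) monoid" where
  "SL2 F = \<lparr>carrier = {A. (\<forall>i j. A $ i $ j \<in> F) \<and> det A = 1}, monoid.mult = (**), monoid.one = mat 1\<rparr>"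

definition scalars :: "'a::field set \<Rightarrow> ('a^2^2) set" where
  "scalars F = {mat c |c. c \<in> F \<and> c \<noteq> 0}"

definition PGL2 :: "'a::field set \<Rightarrow> ('a^2^2) set monoid" where
  "PGL2 F = GL2 F Mod scalars F"

definition PSL2 :: "'a::field set \<Rightarrow> ('a^2^2) set monoid" where
  "PSL2 F = SL2 F Mod (scalars F \<inter> carrier (SL2 F))"

definition proj_class :: "'a::field^2^2 \<Rightarrow> ('a^2^2) set" where
  "proj_class A = scalars UNIV #>\<^bsub>GL2 UNIV\<^esub> A"

definition mat2 :: "'a \<Rightarrow> 'a \<Rightarrow> 'a \<Rightarrow> 'a \<Rightarrow> 'a::zero^2^2" where
  "mat2 a b c d = vector [vector [a, b], vector [c, d]]"

definition primitive_root_of_unity :: "nat \<Rightarrow> 'a::field \<Rightarrow> bool" where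
  "primitive_root_of_unity n x \<longleftrightarrow> n > 0 \<and> x ^ n = 1 \<and> (\<forall>m. 0 < m \<and> m < n \<longrightarrow> x ^ m \<noteq> 1)"


subsection \<open>Regular maps\<close>

text \<open>Type \<open>(k, l)\<close> means vertex degree \<open>k\<close> and face length \<open>l\<close>. The function
  \<open>group.ord\<close> returns 0 for elements of infinite order, so the conditions below do force
  finite orders when \<open>k\<close> and \<open>l\<close> are positive.\<close>

definition regular_map :: "nat \<Rightarrow> nat \<Rightarrow> 'g monoid \<Rightarrow> 'g \<Rightarrow> 'g \<Rightarrow> 'g \<Rightarrow> bool" where
  "regular_map k l G X Y Z \<longleftrightarrow>
     group G \<and> {X, Y, Z} \<subseteq> carrier G \<and> generate G {X, Y, Z} = carrier G \<and>
     group.ord G X = 2 \<and> group.ord G Y = 2 \<and> group.ord G Z = 2 \<and>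
     group.ord G (X \<otimes>\<^bsub>G\<^esub> Y) = 2 \<and>
     group.ord G (Y \<otimes>\<^bsub>G\<^esub> Z) = k \<and>
     group.ord G (Z \<otimes>\<^bsub>G\<^esub> X) = l"

definition self_dual_map :: "nat \<Rightarrow> nat \<Rightarrow> 'g monoid \<Rightarrow> 'g \<Rightarrow> 'g \<Rightarrow> 'g \<Rightarrow> bool" where
  "self_dual_map k l G X Y Z \<longleftrightarrow>
     regular_map k l G X Y Z \<and>
     (\<exists>f \<in> iso G G. (\<forall>g \<in> carrier G. f (f g) = g) \<and> f Z = Z \<and> f X = Y \<and> f Y = X)"

end

theory Submission
  imports Defs
begin

text \<open>The number \<open>\<theta>(A) = (tr A)\<^sup>2 / det A\<close> is a conjugacy invariant on \<open>PGL2(K)\<close>, and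
  \<open>\<theta>(YZ) = \<omega>\<^sub>\<kappa>\<^sup>2\<close>, \<open>\<theta>(XZ) = \<omega>\<^sub>\<lambda>\<^sup>2\<close>.

  Let \<open>SL2(q) \<le> S \<le> GL2(q)\<close>. Every homomorphism \<open>S \<rightarrow> PGL2(K)\<close> whose kernel consists of the scalars
  is, up to conjugation, a power of Frobenius as far as \<open>\<theta>\<close> is concerned: the image of a
  transvection is unipotent, so after conjugation the upper unitriangular group is mapped by an
  additive \<open>\<tau>\<close> and the Weyl element is fixed; the torus action makes \<open>\<tau>\<close> multiplicative, hence
  \<open>\<tau>(x) = x^(p^j)\<close>, and the Bruhat decomposition gives \<open>\<theta>\<close> everywhere. Applying this to an
  isomorphism onto \<open>G\<close> and to its composition with an involutory automorphism \<open>f\<close> of \<open>G\<close> yields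
  \<open>\<theta>(f g) = \<theta>(g)^(p^d)\<close>, where the square of this power of Frobenius is trivial on \<open>GF(q)\<close>, so
  \<open>d = 0\<close> or \<open>2 d = e\<close>. A duality sends \<open>YZ\<close> to \<open>XZ\<close>.

  Conversely, if \<open>\<omega>\<^sub>\<lambda> = \<plusminus> \<omega>\<^sub>\<kappa>^r\<close>, then \<open>D^r = D\<close>, and an explicit matrix \<open>P\<close> conjugates the image
  of \<open>(X, Y, Z)\<close> under the entrywise \<open>r\<close>-th power to \<open>(Y, X, Z)\<close>.\<close>

subsection \<open>Matrices up to scalars\<close>

lemma mat2_nth [simp]:
  "mat2 a b c d $ 1 $ 1 = a" "mat2 a b c d $ 1 $ 2 = b"
  "mat2 a b c d $ 2 $ 1 = c" "mat2 a b c d $ 2 $ 2 = d"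
  by (simp_all add: mat2_def vector_2)

lemma mat2_eq_iff: "A = B \<longleftrightarrow> A$1$1 = B$1$1 \<and> A$1$2 = B$1$2 \<and> A$2$1 = B$2$1 \<and> A$2$2 = B$2$2"
  for A B :: "'a^2^2"
  by (auto simp: vec_eq_iff forall_2)

lemma mat2_eta: "mat2 (A$1$1) (A$1$2) (A$2$1) (A$2$2) = A"
  by (simp add: mat2_eq_iff)

lemma mat2_cases: obtains a b c d where "A = mat2 a b c d"
  by (metis mat2_eta)

lemma mat2_inject [simp]:
  "mat2 a b c d = mat2 a' b' c' d' \<longleftrightarrow> a = a' \<and> b = b' \<and> c = c' \<and> d = d'"
  by (simp add: mat2_eq_iff)

lemma mat2_mult [simp]:
  "mat2 a b c d ** mat2 a' b' c' d' = mat2 (a*a' + b*c') (a*b' + b*d') (c*a' + d*c') (c*b' + d*d')"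
  for a :: "'a::comm_ring_1"
  by (simp add: mat2_eq_iff matrix_matrix_mult_def sum_2)

lemma mat_eq_mat2: "mat c = mat2 c 0 0 c"
  by (simp add: mat2_eq_iff mat_def)

lemma mat_mult_mat2 [simp]: "mat x ** mat2 a b c d = mat2 (x*a) (x*b) (x*c) (x*d)"
  for a :: "'a::comm_ring_1"
  by (simp add: mat_eq_mat2)

lemma det_mat2 [simp]: "det (mat2 a b c d) = a*d - b*c" for a :: "'a::comm_ring_1"
  by (simp add: det_2)

lemma trace_mat2 [simp]: "trace (mat2 a b c d) = a + d" for a :: "'a::comm_ring_1"
  by (simp add: trace_def sum_2)

lemma mat_mult_mat: "mat c ** mat d = (mat (c * d) :: 'a::comm_ring_1^2^2)"
  by (simp add: mat_eq_mat2)

lemma mat_mult_commute: "A ** mat c = mat c ** A" for A :: "'a::comm_ring_1^2^2"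
  by (cases A rule: mat2_cases) (simp add: mat_eq_mat2 mult.commute)

lemma det_mat_2 [simp]: "det (mat c :: 'a::comm_ring_1^2^2) = c * c"
  by (simp add: mat_eq_mat2)

text \<open>Equality in \<open>PGL(2, K)\<close>, stated on matrices so that group relations can be
  verified by entries. Cosets enter only through \<open>cls_eq_iff\<close> and
  \<open>proj_class_eq_iff\<close>.\<close>

definition prop2 :: "'a::field^2^2 \<Rightarrow> 'a^2^2 \<Rightarrow> bool" (infix "\<sim>" 50) where
  "A \<sim> B \<longleftrightarrow> (\<exists>c. c \<noteq> 0 \<and> A = mat c ** B)"

lemma prop2_refl [simp]: "A \<sim> A"
  unfolding prop2_def by (rule exI[of _ 1]) simp

lemma prop2_sym: "A \<sim> B \<Longrightarrow> B \<sim> A"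
  unfolding prop2_def
proof (elim exE conjE)
  fix c assume "c \<noteq> 0" "A = mat c ** B"
  then have "B = mat (inverse c) ** A"
    by (simp add: matrix_mul_assoc mat_mult_mat)
  then show "\<exists>c. c \<noteq> 0 \<and> B = mat c ** A"
    using \<open>c \<noteq> 0\<close> by (intro exI[of _ "inverse c"]) simp
qed

lemma prop2_trans [trans]: "A \<sim> B \<Longrightarrow> B \<sim> C \<Longrightarrow> A \<sim> C"
  by (auto simp: prop2_def matrix_mul_assoc mat_mult_mat intro: exI[of _ "_ * _"])

lemma prop2_mult: "A ** B \<sim> A' ** B'"
  if A: "A \<sim> A'" and B: "B \<sim> B'"
proof -
  obtain a b where ab: "a \<noteq> 0" "A = mat a ** A'" "b \<noteq> 0" "B = mat b ** B'"
    using A B unfolding prop2_def by blast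
  have "A ** B = mat a ** (A' ** mat b) ** B'" by (simp add: ab matrix_mul_assoc)
  also have "\<dots> = mat (a * b) ** (A' ** B')"
    unfolding mat_mult_commute by (simp add: matrix_mul_assoc mat_mult_mat)
  finally show ?thesis using ab(1,3) unfolding prop2_def by (intro exI[of _ "a * b"]) simp
qed

lemma prop2_mat: "c \<noteq> 0 \<Longrightarrow> mat c ** A \<sim> A"
  unfolding prop2_def by blast

lemma prop2_mat_left [simp]: "c \<noteq> 0 \<Longrightarrow> mat c ** A \<sim> B \<longleftrightarrow> A \<sim> B"
  by (meson prop2_mat prop2_sym prop2_trans)

definition theta :: "'a::field^2^2 \<Rightarrow> 'a" where
  "theta A = (trace A)\<^sup>2 / det A"

lemma theta_mat2: "theta (mat2 a b c d) = (a + d)\<^sup>2 / (a*d - b*c)"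
  by (simp add: theta_def)

lemma theta_prop2: "A \<sim> B \<Longrightarrow> theta A = theta B"
  by (cases B rule: mat2_cases)
     (auto simp: prop2_def det_mul theta_mat2 power2_eq_square divide_simps algebra_simps)

definition adj2 :: "'a::field^2^2 \<Rightarrow> 'a^2^2" where
  "adj2 A = mat2 (A$2$2) (- A$1$2) (- A$2$1) (A$1$1)"

lemma adj2_mat2 [simp]: "adj2 (mat2 a b c d) = mat2 d (-b) (-c) a"
  by (simp add: adj2_def)

lemma adj2_mult: "A ** adj2 A = mat (det A)" "adj2 A ** A = mat (det A)"
  by (cases A rule: mat2_cases; simp add: mat_eq_mat2 algebra_simps)+

lemma det_adj2 [simp]: "det (adj2 A) = det A"
  by (cases A rule: mat2_cases) (simp add: algebra_simps)

text \<open>Conjugation by \<open>P\<close> up to the scalar \<open>det P\<close>, which avoids inverse matrices.\<close>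

definition conj2 :: "'a::field^2^2 \<Rightarrow> 'a^2^2 \<Rightarrow> 'a^2^2" where
  "conj2 P A = P ** A ** adj2 P"

lemma conj2_mult: "conj2 P A ** conj2 P B = mat (det P) ** conj2 P (A ** B)"
proof -
  have "conj2 P A ** conj2 P B = P ** A ** (adj2 P ** P) ** B ** adj2 P"
    by (simp add: conj2_def matrix_mul_assoc)
  also have "\<dots> = mat (det P) ** conj2 P (A ** B)"
    unfolding adj2_mult mat_mult_commute by (simp add: conj2_def matrix_mul_assoc)
  finally show ?thesis .
qed

lemma conj2_conj2: "conj2 P (conj2 Q A) = conj2 (P ** Q) A"
proof -
  have "adj2 Q ** adj2 P = adj2 (P ** Q)"
    by (cases P rule: mat2_cases; cases Q rule: mat2_cases) (simp add: algebra_simps)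
  then show ?thesis by (simp add: conj2_def flip: matrix_mul_assoc)
qed

lemma det_conj2: "det (conj2 P A) = (det P)\<^sup>2 * det A"
  by (simp add: conj2_def det_mul power2_eq_square)

lemma trace_conj2: "trace (conj2 P A) = det P * trace A"
  by (cases P rule: mat2_cases; cases A rule: mat2_cases) (simp add: conj2_def algebra_simps)

lemma theta_conj2: "det P \<noteq> 0 \<Longrightarrow> theta (conj2 P A) = theta A"
  by (simp add: theta_def det_conj2 trace_conj2 power_mult_distrib)

lemma conj2_prop2: "A \<sim> B \<Longrightarrow> conj2 P A \<sim> conj2 P B"
  unfolding conj2_def by (intro prop2_mult) auto

lemma conj2_mat: "conj2 P (mat c) = mat (c * det P)"
  by (cases P rule: mat2_cases) (simp add: conj2_def mat_eq_mat2 algebra_simps)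

lemma conj2_adj2: "conj2 (adj2 P) (conj2 P A) = mat ((det P)\<^sup>2) ** A"
  unfolding conj2_conj2 adj2_mult
  by (cases A rule: mat2_cases) (simp add: conj2_def mat_eq_mat2 power2_eq_square)

lemma conj2_prop2_iff: 
  assumes "det P \<noteq> 0"
  shows "conj2 P A \<sim> conj2 P B \<longleftrightarrow> A \<sim> B"
proof
  assume "conj2 P A \<sim> conj2 P B"
  then have "conj2 (adj2 P) (conj2 P A) \<sim> conj2 (adj2 P) (conj2 P B)" by (rule conj2_prop2)
  then show "A \<sim> B" unfolding conj2_adj2 using assms
    by (metis power_not_zero prop2_mat_left prop2_sym)
qed (rule conj2_prop2)

lemma conj2_prop2_mat_iff: 
  assumes "det P \<noteq> 0"
  shows "conj2 P A \<sim> mat 1 \<longleftrightarrow> A \<sim> mat 1"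
proof -
  have "conj2 P (mat 1) = mat (det P) ** mat 1"
    by (simp add: conj2_mat)
  then have "conj2 P A \<sim> mat 1 \<longleftrightarrow> conj2 P A \<sim> conj2 P (mat 1)"
    using assms by (metis prop2_mat_left prop2_sym)
  then show ?thesis using assms conj2_prop2_iff by blast
qed

text \<open>The intertwining relation is linear in each occurrence of \<open>P\<close>; explicit
  conjugating matrices are checked in this form.\<close>

lemma conj2_prop2I:
  assumes "det P \<noteq> 0" "P ** A \<sim> B ** P"
  shows "conj2 P A \<sim> B"
proof -
  have "conj2 P A \<sim> B ** P ** adj2 P" unfolding conj2_def
    by (rule prop2_mult[OF assms(2)]) simp
  also have "B ** P ** adj2 P = mat (det P) ** B"
    by (simp only: adj2_mult mat_mult_commute flip: matrix_mul_assoc)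
  also have "\<dots> \<sim> B" using assms(1) by simp
  finally show ?thesis .
qed

lemma prop2_mat_1_iff: "A \<sim> mat 1 \<longleftrightarrow> (\<exists>c. c \<noteq> 0 \<and> A = mat c)"
  by (simp add: prop2_def)

subsection \<open>Homomorphisms of finite fields\<close>

locale finite_subfield =
  fixes p q e :: nat and F :: "'a::alg_closed_field set"
  assumes char: "CHAR('a) = p" and prime_p: "prime p" and odd_p: "odd p"
    and e_pos: "e \<ge> 1" and q_def: "q = p ^ e" and F_def: "F = GF q"
begin

lemma F_iff: "x \<in> F \<longleftrightarrow> x ^ q = x"
  by (simp add: F_def GF_def)

lemma frob_add: "(x + y) ^ (p ^ j) = x ^ (p ^ j) + y ^ (p ^ j)" for x y :: 'a
  by (rule freshmans_dream') (use char prime_p in auto)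

lemma p_gt_2: "p > 2"
  using prime_p odd_p by (metis dvd_refl le_neq_implies_less prime_ge_2_nat)

lemma frob_minus: "(- x) ^ (p ^ j) = - (x ^ (p ^ j))" for x :: 'a
  using odd_p by simp

lemma frob_diff: "(x - y) ^ (p ^ j) = x ^ (p ^ j) - y ^ (p ^ j)" for x y :: 'a
  using frob_add[of x "- y" j] frob_minus[of y j] by simp

lemma frob_eq_iff: "x ^ (p ^ j) = y ^ (p ^ j) \<longleftrightarrow> x = y" for x y :: 'a
  using frob_diff[of x y j] by (metis eq_iff_diff_eq_0 frob_diff pow_divides_pow_iff power_eq_0_iff power_0 right_minus_eq)

lemma two_nonzero [simp]: "(2::'a) \<noteq> 0"
proof -
  have "\<not> p dvd 2" using p_gt_2 by (auto dest: dvd_imp_le)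
  then have "of_nat 2 \<noteq> (0::'a)" by (metis char of_nat_eq_0_iff_char_dvd)
  then show ?thesis by simp
qed

lemma zero_F [simp]: "0 \<in> F" and one_F [simp]: "1 \<in> F"
  and diff_F [intro]: "x \<in> F \<Longrightarrow> y \<in> F \<Longrightarrow> x - y \<in> F"
  and mult_F [intro]: "x \<in> F \<Longrightarrow> y \<in> F \<Longrightarrow> x * y \<in> F"
  and inverse_F [intro]: "x \<in> F \<Longrightarrow> inverse x \<in> F"
  using GF_subfield[where ?'a = 'a, of q e] char prime_p q_def F_def by auto

lemma uminus_F [intro]: "x \<in> F \<Longrightarrow> - x \<in> F"
  using diff_F[of 0 x] by simp

lemma add_F [intro]: "x \<in> F \<Longrightarrow> y \<in> F \<Longrightarrow> x + y \<in> F"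
  using diff_F[of x "- y"] by auto

lemma divide_F [intro]: "x \<in> F \<Longrightarrow> y \<in> F \<Longrightarrow> x / y \<in> F"
  by (simp add: divide_inverse mult_F inverse_F)

lemma power_F [intro]: "x \<in> F \<Longrightarrow> x ^ n \<in> F"
  by (induction n) auto

lemma card_F: "card F = q"
  unfolding F_def by (rule card_GF[of q e]) (use char prime_p e_pos q_def in auto)

lemma q_gt_2: "q > 2"
  using p_gt_2 e_pos q_def by (metis One_nat_def Suc_le_eq dual_order.strict_trans2 order_less_le self_le_power less_nat_zero_code not_gr_zero one_le_numeral order_trans)

lemma finite_F: "finite F"
  using card_F q_gt_2 by (metis card.infinite less_nat_zero_code)

text \<open>As \<open>2\<close> is invertible, every element is a difference of squares. This
  extends to all of \<open>F\<close> what the group yields only for squares.\<close>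

lemma diff_squares: "x = ((x + 1) / 2)\<^sup>2 - ((x - 1) / 2)\<^sup>2" for x :: 'a
proof -
  have "((x + 1) / 2)\<^sup>2 - ((x - 1) / 2)\<^sup>2 = (((x + 1) - (x - 1)) / 2) * (((x + 1) + (x - 1)) / 2)"
    unfolding power2_eq_square square_diff_square_factored
    by (simp add: add_divide_distrib diff_divide_distrib algebra_simps)
  also have "(x + 1) - (x - 1) = 2" by simp
  also have "(x + 1) + (x - 1) = 2 * x" by simp
  finally show ?thesis by simp
qed

lemma half_F: "x \<in> F \<Longrightarrow> x / 2 \<in> F"
  using add_F[OF one_F one_F] by (auto simp: one_add_one)

lemma square_diffE:
  assumes "x \<in> F" obtains a b where "a \<in> F" "b \<in> F" "x = a\<^sup>2 - b\<^sup>2"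
  using diff_squares[of x] half_F[OF add_F[OF assms one_F]] half_F[OF diff_F[OF assms one_F]] by blast

lemma ex_generator: "\<exists>g\<in>F. g \<noteq> 0 \<and> (\<forall>x\<in>F. x \<noteq> 0 \<longrightarrow> (\<exists>i::nat. x = g ^ i))"
proof -
  \<comment> \<open>\<open>F\<close> is packaged as a ring with explicit carrier, to which the
    cyclicity of the unit group of a finite field applies.\<close>
  define R :: "'a ring" where "R = \<lparr>carrier = F, monoid.mult = (*), one = 1, zero = 0, add = (+)\<rparr>"
  have "cring R"
    by (intro cringI abelian_groupI comm_monoidI)
       (auto simp: R_def algebra_simps intro!: bexI[of _ "- _"])
  then interpret cring R .
  have "field R"
    by (rule cring_fieldI2) (auto simp: R_def intro!: bexI[of _ "inverse _"])
  then interpret field R .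
  have pow: "x [^]\<^bsub>R\<^esub> (i::nat) = x ^ i" for x i
    by (induction i) (simp_all add: R_def nat_pow_def mult.commute)
  obtain g where g: "g \<in> carrier (mult_of R)" "carrier (mult_of R) = {g [^]\<^bsub>R\<^esub> i | i::nat. i \<in> UNIV}"
    using finite_field_mult_group_has_gen finite_F by (auto simp: R_def)
  show ?thesis
  proof (intro bexI conjI ballI impI)
    show "g \<in> F" "g \<noteq> 0" using g(1) by (auto simp: R_def)
    show "\<exists>i::nat. x = g ^ i" if "x \<in> F" "x \<noteq> 0" for x
    proof -
      have "x \<in> carrier (mult_of R)" using that by (simp add: R_def)
      then show ?thesis using g(2) unfolding pow by blast
    qed
  qed
qed

text \<open>A power map on \<open>F\<close> that is additive has exponent \<open>p ^ j\<close>: after removing the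
  powers of \<open>p\<close> from the exponent, \<open>(x + 1) ^ n - x ^ n - 1\<close> has more roots than its degree
  permits, and its linear coefficient is \<open>n\<close>.\<close>

lemma additive_power_eq_frob:
  assumes m: "0 < m" "m < q" and add: "\<And>x. x \<in> F \<Longrightarrow> (x + 1) ^ m = x ^ m + 1"
  shows "\<exists>j<e. m = p ^ j"
proof -
  define j where "j = multiplicity p m"
  obtain n where n: "m = p ^ j * n" "\<not> p dvd n"
    using multiplicity_decompose'[of m p] m prime_p unfolding j_def
    by (metis not_prime_unit not_less_zero multiplicity_decompose')
  have n0: "n > 0" using n m by (auto intro: Nat.gr0I)
  have "p ^ j \<ge> 1" using prime_p by (simp add: prime_gt_0_nat Suc_le_eq)
  then have nq: "n < q" using n(1) m(2)
    by (metis le_less_trans mult.commute mult_le_mono2 mult.right_neutral)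
  \<comment> \<open>The \<open>p ^ j\<close>-th power map is injective on the finite set
    \<open>F\<close>, hence permutes it; so additivity descends from the exponent \<open>m\<close>
    to \<open>n\<close>.\<close>
  have inj: "inj_on (\<lambda>x. x ^ (p ^ j)) F"
    by (rule inj_onI) (simp add: frob_eq_iff)
  have surj: "(\<lambda>x. x ^ (p ^ j)) ` F = F"
    by (rule endo_inj_surj[OF finite_F _ inj]) auto
  have add': "(y + 1) ^ n = y ^ n + 1" if y: "y \<in> F" for y
  proof -
    obtain x where x: "x \<in> F" "y = x ^ (p ^ j)" using surj y by blast
    have "(y + 1) ^ n = ((x + 1) ^ (p ^ j)) ^ n"
      using frob_add[of x 1 j] x by simp
    also have "\<dots> = (x + 1) ^ m" by (simp add: n power_mult)
    also have "\<dots> = x ^ m + 1" by (rule add[OF x(1)])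
    also have "x ^ m = y ^ n" by (simp add: x(2) n power_mult)
    finally show ?thesis .
  qed
  define Q :: "'a poly" where "Q = [:1, 1:] ^ n - (monom 1 n + 1)"
  have "degree Q \<le> n"
    unfolding Q_def
    by (intro degree_diff_le degree_add_le degree_monom_le order_trans[OF degree_power_le]) auto
  moreover have "F \<subseteq> {x. poly Q x = 0}"
    using add' by (auto simp: Q_def poly_monom add.commute)
  ultimately have "Q = 0"
    using card_poly_roots_bound[of Q] card_mono[of "{x. poly Q x = 0}" F] poly_roots_finite[of Q]
      card_F nq by (cases "Q = 0") auto
  then have "poly (pderiv Q) 0 = 0" by simp
  \<comment> \<open>For \<open>n > 1\<close> the right-hand side vanishes although \<open>n\<close>
    is prime to \<open>p\<close>; only \<open>n = 1\<close> survives, through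
    \<open>0 ^ 0 = 1\<close>.\<close>
  then have "of_nat n = of_nat n * (0::'a) ^ (n - 1)"
    by (simp add: Q_def pderiv_diff pderiv_add pderiv_power pderiv_monom pderiv_pCons poly_monom)
  moreover have "of_nat n \<noteq> (0::'a)"
    using n(2) by (metis char of_nat_eq_0_iff_char_dvd)
  ultimately have "(0::'a) ^ (n - 1) = 1" by simp
  then have "n = 1" using n0 by (cases "n = 1") (auto simp: power_0_left split: if_splits)
  then have "m = p ^ j" using n by simp
  moreover from this have "j < e" using m(2) q_def prime_p
    by (metis power_strict_increasing_iff prime_gt_1_nat)
  ultimately show ?thesis by blast
qed

text \<open>\<open>\<tau>\<close> respects the equation \<open>x ^ q = x\<close>, so it maps
  \<open>F\<close> into itself. It sends a generator \<open>g\<close> of the unit group to a power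
  \<open>g ^ m\<close>, hence is the \<open>m\<close>-th power map, and additivity makes
  \<open>m\<close> a power of \<open>p\<close>.\<close>

lemma field_hom_eq_frob:
  assumes add: "\<And>x y. x \<in> F \<Longrightarrow> y \<in> F \<Longrightarrow> \<tau> (x + y) = \<tau> x + (\<tau> y :: 'a)"
    and mult: "\<And>x y. x \<in> F \<Longrightarrow> y \<in> F \<Longrightarrow> \<tau> (x * y) = \<tau> x * \<tau> y"
    and one: "\<tau> 1 = 1"
  shows "\<exists>j<e. \<forall>x\<in>F. \<tau> x = x ^ (p ^ j)"
proof -
  have zero: "\<tau> 0 = 0" using add[of 0 0] by (metis add.right_neutral add_left_cancel zero_F)
  have pow: "\<tau> (x ^ n) = \<tau> x ^ n" if "x \<in> F" for x n
    by (induction n) (simp_all add: one mult[OF that power_F[OF that]])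
  have clos: "\<tau> x \<in> F" if "x \<in> F" for x
    using pow[OF that, of q] that by (simp add: F_iff)
  obtain g where g: "g \<in> F" "g \<noteq> 0" "\<And>x. x \<in> F \<Longrightarrow> x \<noteq> 0 \<Longrightarrow> \<exists>i::nat. x = g ^ i"
    using ex_generator by blast
  have gq: "g ^ (q - 1) = 1"
  proof -
    have "g * g ^ (q - 1) = g * 1" using g(1) q_gt_2 by (simp add: F_iff flip: power_Suc)
    then show ?thesis using g(2) by (metis mult_left_cancel)
  qed
  have "\<tau> g \<noteq> 0" 
  proof
    assume "\<tau> g = 0"
    then have "\<tau> (g ^ (q - 1)) = 0" using pow[OF g(1), of "q - 1"] q_gt_2 by simp
    then show False using gq one by simp
  qed
  then obtain i where i: "\<tau> g = g ^ i" using g(3) clos[OF g(1)] by blast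
  define r where "r = i mod (q - 1)"
  \<comment> \<open>The exponent \<open>0\<close> is replaced by \<open>q - 1\<close>, which agrees
    on units and makes \<open>0 ^ m = 0\<close> match \<open>\<tau> 0 = 0\<close>.\<close>
  define m where "m = (if r = 0 then q - 1 else r)"
  have "r < q - 1" using q_gt_2 by (simp add: r_def)
  then have m: "0 < m" "m < q"
    using q_gt_2 by (auto simp: m_def)
  have "g ^ i = g ^ r" unfolding r_def
    by (subst mult_div_mod_eq[of "q - 1" i, symmetric]) (simp only: power_add power_mult gq, simp)
  then have gm: "\<tau> g = g ^ m" using gq i by (auto simp: m_def)
  have taum: "\<tau> x = x ^ m" if x: "x \<in> F" for x
  proof (cases "x = 0")
    case True
    then show ?thesis using zero m by simp
  next
    case False
    then obtain n where n: "x = g ^ n" using g(3) x by blast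
    have "\<tau> (g ^ n) = (g ^ m) ^ n" unfolding gm[symmetric] by (rule pow[OF g(1)])
    also have "\<dots> = (g ^ n) ^ m" by (subst (1 2) power_mult[symmetric]) (simp only: mult.commute)
    finally show ?thesis by (simp only: n)
  qed
  have "(x + 1) ^ m = x ^ m + 1" if "x \<in> F" for x
    using add[OF that one_F] taum[OF that] taum[OF add_F[OF that one_F]] one by simp
  from additive_power_eq_frob[OF m this] taum show ?thesis by auto
qed

text \<open>Otherwise \<open>2 * d\<close>, reduced modulo \<open>e\<close>, is some
  \<open>r\<close> with \<open>0 < r < e\<close>, and all \<open>p ^ e\<close> elements of
  \<open>F\<close> would lie in the field of order \<open>p ^ r\<close>.\<close>

lemma frob_square_trivial:
  assumes "\<And>x. x \<in> F \<Longrightarrow> x ^ (p ^ (2 * d)) = x" and "d < e"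
  shows "d = 0 \<or> 2 * d = e"
proof (rule ccontr)
  assume neg: "\<not> (d = 0 \<or> 2 * d = e)"
  obtain r where r: "0 < r" "r < e" "\<And>x. x \<in> F \<Longrightarrow> x ^ (p ^ r) = x"
  proof (cases "2 * d < e")
    case True
    then show ?thesis using that[of "2 * d"] neg assms(1) by simp
  next
    case False
    have "x ^ (p ^ (2 * d - e)) = x" if x: "x \<in> F" for x
    proof -
      have "x ^ (p ^ (2 * d)) = (x ^ q) ^ (p ^ (2 * d - e))"
        using False by (simp add: q_def flip: power_mult power_add)
      then show ?thesis using assms(1)[OF x] x by (simp add: F_iff)
    qed
    then show ?thesis using that[of "2 * d - e"] False neg assms(2) by auto
  qed
  have "F \<subseteq> GF (p ^ r)" using r(3) by (auto simp: GF_def)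
  moreover have card: "card (GF (p ^ r) :: 'a set) = p ^ r"
    using char prime_p r(1) by (intro card_GF[of _ r]) auto
  moreover have "finite (GF (p ^ r) :: 'a set)"
    using card prime_p by (metis card.infinite not_prime_0 power_eq_0_iff)
  ultimately have "p ^ e \<le> p ^ r" using card_mono card_F q_def by metis
  then show False using r(2) prime_p
    by (metis leD power_strict_increasing_iff prime_gt_1_nat)
qed

end

subsection \<open>Projective representations of linear groups over a finite field\<close>

lemma conj2_upper_triangular:
  fixes M :: "'a::alg_closed_field^2^2"
  obtains P a b d where "det P \<noteq> 0" "conj2 P M = mat2 a b 0 d"
proof -
  obtain m n l k where M: "M = mat2 m n l k" by (rule mat2_cases)
  show ?thesis
  proof (cases "l = 0")
    case True
    show ?thesis by (rule that[of "mat2 1 0 0 1"]) (auto simp: M True conj2_def)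
  next
    case False
    obtain z where z: "poly [:m * k - n * l, - (m + k), 1:] z = 0"
      using alg_closed_imp_poly_has_root[of "[:m * k - n * l, - (m + k), 1:]"] by auto
    \<comment> \<open>The second row of \<open>P\<close> is a left eigenvector of \<open>M\<close>
      for the eigenvalue \<open>m + k - z\<close>, which clears the lower left entry after
      conjugation.\<close>
    define P where "P = mat2 0 (-1) (-l) (z - k)"
    have "(conj2 P M) $ 2 $ 1 = l * poly [:m * k - n * l, - (m + k), 1:] z"
      by (simp add: conj2_def P_def M algebra_simps)
    then have "(conj2 P M) $ 2 $ 1 = 0" using z by simp
    then have "conj2 P M = mat2 (conj2 P M $ 1 $ 1) (conj2 P M $ 1 $ 2) 0 (conj2 P M $ 2 $ 2)"
      by (simp add: mat2_eq_iff)
    moreover have "det P \<noteq> 0" using False by (simp add: P_def)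
    ultimately show ?thesis using that by blast
  qed
qed

lemma mat2_prop2_1_iff: "mat2 a b c d \<sim> mat 1 \<longleftrightarrow> a = d \<and> b = 0 \<and> c = 0 \<and> a \<noteq> 0"
  unfolding prop2_mat_1_iff unfolding mat_eq_mat2 by auto

text \<open>Cayley-Hamilton writes the cube of \<open>V\<close> as
  \<open>s V - (tr V) (det V)\<close> with \<open>s = (tr V)\<^sup>2 - det V\<close>. If
  \<open>s\<close> is nonzero and the cube is scalar, so is \<open>V\<close>.\<close>

lemma cube_scalar:
  assumes "V ** V ** V \<sim> mat 1" "\<not> V \<sim> mat 1" "det V \<noteq> 0"
  shows "(trace V)\<^sup>2 = det V"
proof (rule ccontr)
  assume neq: "(trace V)\<^sup>2 \<noteq> det V"
  obtain a b c d where V: "V = mat2 a b c d" by (rule mat2_cases)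
  define s where "s = (a + d)\<^sup>2 - (a * d - b * c)"
  have s: "s \<noteq> 0" using neq by (simp add: V s_def)
  obtain x where "V ** V ** V = mat x" using assms(1) by (auto simp: prop2_mat_1_iff)
  then have x: "(a*a + b*c)*a + (a*b + b*d)*c = x" "(a*a + b*c)*b + (a*b + b*d)*d = 0"
    "(c*a + d*c)*a + (c*b + d*d)*c = 0" "(c*a + d*c)*b + (c*b + d*d)*d = x"
    by (simp_all add: V mat_eq_mat2)
  have "s * b = (a*a + b*c)*b + (a*b + b*d)*d" by (simp add: s_def power2_eq_square algebra_simps)
  then have b: "b = 0" using s x(2) by simp
  have "s * c = (c*a + d*c)*a + (c*b + d*d)*c" by (simp add: s_def power2_eq_square algebra_simps)
  then have c: "c = 0" using s x(3) by simp
  have "s * (a - d) = ((a*a + b*c)*a + (a*b + b*d)*c) - ((c*a + d*c)*b + (c*b + d*d)*d)"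
    by (simp add: s_def power2_eq_square algebra_simps)
  then have "a = d" using s x(1,4) by simp
  then have "V \<sim> mat 1" using b c assms(3) by (auto simp: mat2_prop2_1_iff V)
  then show False using assms(2) by simp
qed

definition unip :: "'a::field \<Rightarrow> 'a^2^2" where "unip t = mat2 1 t 0 1"

definition weyl :: "'a::field^2^2" where "weyl = mat2 0 1 (-1) 0"

lemma unip_mult: "unip s ** unip t = unip (s + t)"
  by (simp add: unip_def add.commute)

lemma unip_0: "unip 0 = mat 1"
  by (simp add: unip_def mat_eq_mat2)

lemma unip_prop2_iff [simp]: "unip s \<sim> unip t \<longleftrightarrow> s = t"
  by (auto simp: unip_def prop2_def)

lemma unip_prop2_1_iff [simp]: "unip s \<sim> mat 1 \<longleftrightarrow> s = 0"
  by (metis unip_0 unip_prop2_iff)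

text \<open>A nontrivial upper unipotent fixes a single point of the projective line.
  \<open>M\<close> preserves that point, so it is triangular, and its diagonal ratio rescales the
  parameter.\<close>

lemma intertwine_unip:
  assumes "M ** unip x \<sim> unip y ** M" "det M \<noteq> 0" "y \<noteq> 0"
  shows "M$2$1 = 0" "M$1$1 * x = y * M$2$2" "M$1$1 \<noteq> 0" "M$2$2 \<noteq> 0"
proof -
  obtain m n l k where M: "M = mat2 m n l k" by (rule mat2_cases)
  obtain c where c: "c \<noteq> 0" "m = c * (m + y * l)" "m * x + n = c * (n + y * k)" "l = c * l"
    using assms(1) by (auto simp: prop2_def M unip_def)
  have l: "l = 0"
  proof (rule ccontr)
    assume "l \<noteq> 0"
    then have "c = 1" using c(4) by simp
    then show False using c(2) assms(3) \<open>l \<noteq> 0\<close> by simp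
  qed
  then have mk: "m \<noteq> 0" "k \<noteq> 0" using assms(2) by (auto simp: M)
  then have "c = 1" using c(2) l by simp
  then show "M$2$1 = 0" "M$1$1 * x = y * M$2$2" "M$1$1 \<noteq> 0" "M$2$2 \<noteq> 0"
    using c(3) mk l by (simp_all add: M)
qed

text \<open>An injective homomorphism from \<open>S\<close> modulo scalars to
  \<open>PGL(2, K)\<close>, given by chosen matrices; hence multiplicativity only up to scalars.
  Leaving \<open>S\<close> between \<open>SL2\<close> and \<open>GL2\<close> treats
  \<open>PSL\<close> and \<open>PGL\<close> together.\<close>

locale proj_rep = finite_subfield p q e F for p q e and F :: "'a::alg_closed_field set" +
  fixes S :: "('a^2^2) set" and R :: "'a^2^2 \<Rightarrow> 'a^2^2"
  assumes SL2_sub: "\<lbrakk>a \<in> F; b \<in> F; c \<in> F; d \<in> F; a * d - b * c = 1\<rbrakk> \<Longrightarrow> mat2 a b c d \<in> S"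
    and sub_GL2: "mat2 a b c d \<in> S \<Longrightarrow> a \<in> F \<and> b \<in> F \<and> c \<in> F \<and> d \<in> F \<and> a * d - b * c \<noteq> 0"
    and S_mult: "\<lbrakk>A \<in> S; B \<in> S\<rbrakk> \<Longrightarrow> A ** B \<in> S"
    and R_det: "A \<in> S \<Longrightarrow> det (R A) \<noteq> 0"
    and R_mult: "\<lbrakk>A \<in> S; B \<in> S\<rbrakk> \<Longrightarrow> R (A ** B) \<sim> R A ** R B"
    and R_scalar: "A \<in> S \<Longrightarrow> R A \<sim> mat 1 \<longleftrightarrow> A \<sim> mat 1"
begin

lemma unip_S [simp]: "t \<in> F \<Longrightarrow> unip t \<in> S"
  unfolding unip_def by (rule SL2_sub) auto

lemma weyl_S [simp]: "weyl \<in> S"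
  unfolding weyl_def by (rule SL2_sub) auto

lemma conj: 
  assumes "det P \<noteq> 0"
  shows "proj_rep p q e F S (\<lambda>A. conj2 P (R A))"
proof (intro proj_rep.intro proj_rep_axioms.intro finite_subfield_axioms)
  show "mat2 a b c d \<in> S" if "a \<in> F" "b \<in> F" "c \<in> F" "d \<in> F" "a * d - b * c = 1" for a b c d
    using that by (rule SL2_sub)
  show "a \<in> F \<and> b \<in> F \<and> c \<in> F \<and> d \<in> F \<and> a * d - b * c \<noteq> 0" if "mat2 a b c d \<in> S" for a b c d
    using that by (rule sub_GL2)
  fix A B assume A: "A \<in> S"
  show "det (conj2 P (R A)) \<noteq> 0" using R_det[OF A] assms by (simp add: det_conj2)
  show "conj2 P (R A) \<sim> mat 1 \<longleftrightarrow> A \<sim> mat 1"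
    using R_scalar[OF A] conj2_prop2_mat_iff[OF assms] by blast
  assume B: "B \<in> S"
  show "A ** B \<in> S" using A B by (rule S_mult)
  have "conj2 P (R (A ** B)) \<sim> conj2 P (R A ** R B)"
    using A B by (intro conj2_prop2 R_mult)
  also have "\<dots> \<sim> mat (det P) ** \<dots>"
    using assms by (simp add: prop2_sym)
  finally show "conj2 P (R (A ** B)) \<sim> conj2 P (R A) ** conj2 P (R B)"
    by (simp add: conj2_mult)
qed

lemma R_one: "R (mat 1) \<sim> mat 1"
  using R_scalar[of "mat 1"] unip_S[of 0] by (simp add: unip_0)

lemma of_nat_F: "of_nat n \<in> F"
  by (induction n) auto

text \<open>\<open>unip 1\<close> has order \<open>p\<close>, so the diagonal entries of its
  triangularised image have equal \<open>p\<close>-th powers and therefore coincide. The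
  off-diagonal entry is nonzero by injectivity and can be rescaled.\<close>

lemma ex_unip_normal: "\<exists>P. det P \<noteq> 0 \<and> conj2 P (R (unip 1)) \<sim> unip 1"
proof -
  obtain P a b d where P: "det P \<noteq> 0" "conj2 P (R (unip 1)) = mat2 a b 0 d"
    by (rule conj2_upper_triangular)
  interpret C: proj_rep p q e F S "\<lambda>A. conj2 P (R A)" by (rule conj[OF P(1)])
  have ad: "a \<noteq> 0" "d \<noteq> 0" using C.R_det[of "unip 1"] P(2) by auto
  have pow: "\<exists>x. conj2 P (R (unip (of_nat n))) \<sim> mat2 (a ^ n) x 0 (d ^ n)" for n
  proof (induction n)
    case 0
    show ?case using C.R_one by (auto simp: unip_0 mat_eq_mat2)
  next
    case (Suc n)
    then obtain x where x: "conj2 P (R (unip (of_nat n))) \<sim> mat2 (a ^ n) x 0 (d ^ n)" ..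
    have "unip (of_nat (Suc n)) = unip 1 ** unip (of_nat n)" by (simp add: unip_mult)
    then have "conj2 P (R (unip (of_nat (Suc n)))) \<sim> conj2 P (R (unip 1)) ** conj2 P (R (unip (of_nat n)))"
      using C.R_mult[OF unip_S[OF one_F] unip_S[OF of_nat_F]] by metis
    also have "\<dots> \<sim> mat2 a b 0 d ** mat2 (a ^ n) x 0 (d ^ n)"
      using x P(2) by (intro prop2_mult) auto
    finally show ?case by auto
  qed
  obtain x where "conj2 P (R (unip (of_nat p))) \<sim> mat2 (a ^ p) x 0 (d ^ p)" using pow by blast
  then have "conj2 P (R (mat 1)) \<sim> mat2 (a ^ p) x 0 (d ^ p)"
    using char by (metis of_nat_CHAR unip_0)
  then have "mat2 (a ^ p) x 0 (d ^ p) \<sim> mat 1"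
    using C.R_one prop2_sym prop2_trans by blast
  then have "a ^ (p ^ 1) = d ^ (p ^ 1)" by (simp add: mat2_prop2_1_iff)
  then have a_eq_d: "a = d" by (simp only: frob_eq_iff)
  have b: "b \<noteq> 0"
  proof
    assume "b = 0"
    then have "conj2 P (R (unip 1)) \<sim> mat 1"
      using P(2) a_eq_d ad by (simp add: mat2_prop2_1_iff)
    then show False using C.R_scalar[of "unip 1"] by simp
  qed
  \<comment> \<open>Conjugation by \<open>mat2 a 0 0 b\<close> multiplies the off-diagonal ratio
    \<open>b / a\<close> by \<open>a / b\<close>, making it \<open>1\<close>.\<close>
  define Q where "Q = mat2 a 0 0 b ** P"
  have "conj2 Q (R (unip 1)) = conj2 (mat2 a 0 0 b) (mat2 a b 0 a)"
    unfolding Q_def conj2_conj2[symmetric] P(2) a_eq_d ..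
  also have "\<dots> = mat (a * a * b) ** unip 1"
    by (simp add: conj2_def unip_def algebra_simps)
  also have "\<dots> \<sim> unip 1" using ad b by simp
  finally show ?thesis using P(1) ad b by (intro exI[of _ Q]) (simp add: Q_def det_mul)
qed

text \<open>Two relations determine the image of \<open>weyl\<close>. Its square is scalar, so it
  has trace zero; the cube of \<open>weyl ** unip 1\<close> is the identity, so
  \<open>cube_scalar\<close> gives \<open>c * c = det V\<close>. Conjugation by some
  \<open>unip x\<close>, which leaves \<open>unip 1\<close> alone, does the rest.\<close>

lemma ex_weyl_normal:
  assumes u1: "R (unip 1) \<sim> unip 1"
  shows "\<exists>x. conj2 (unip x) (R weyl) \<sim> weyl"
proof -
  obtain a b c d where W: "R weyl = mat2 a b c d" by (rule mat2_cases)
  have "R weyl ** R weyl \<sim> R (weyl ** weyl)" using R_mult[of weyl weyl] by (simp add: prop2_sym)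
  moreover have "weyl ** weyl \<sim> (mat 1 :: 'a^2^2)"
    by (simp add: weyl_def mat2_prop2_1_iff)
  then have "R (weyl ** weyl) \<sim> mat 1" using R_scalar S_mult by simp
  ultimately have "R weyl ** R weyl \<sim> mat 1" by (rule prop2_trans)
  then have eqs: "a * a + b * c = c * b + d * d" "b * (a + d) = 0" "c * (a + d) = 0"
    by (simp_all add: W mat2_prop2_1_iff distrib_left mult.commute)
  have ns: "\<not> R weyl \<sim> mat 1"
    using R_scalar[OF weyl_S] by (metis mat2_prop2_1_iff weyl_def zero_neq_one)
  have d: "d = - a"
  proof (rule ccontr)
    assume "d \<noteq> - a"
    then have n0: "a + d \<noteq> 0" by (metis add_eq_0_iff)
    then have bc: "b = 0" "c = 0" using eqs by auto
    have "(a - d) * (a + d) = 0" using eqs(1) bc by (simp add: algebra_simps)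
    then have "a = d" using n0 by simp
    moreover have "a \<noteq> 0" using n0 \<open>a = d\<close> by auto
    ultimately show False using ns bc by (simp add: W mat2_prop2_1_iff)
  qed
  define V where "V = R weyl ** unip 1"
  have V: "V = mat2 a (a + b) c (c - a)" by (simp add: V_def W d unip_def)
  have detV: "det V = - a * a - b * c" by (simp add: V algebra_simps)
  have "det V \<noteq> 0" using R_det[of weyl] by (simp add: V_def det_mul unip_def)
  have RV: "R (weyl ** unip 1) \<sim> V" unfolding V_def
    using R_mult[of weyl "unip 1"] prop2_mult[OF prop2_refl u1] prop2_trans by (metis one_F unip_S weyl_S)
  define m where "m = weyl ** unip (1::'a)"
  have mS: "m \<in> S" by (simp add: m_def S_mult)
  have "m ** m ** m = mat 1" by (simp add: m_def weyl_def unip_def mat_eq_mat2)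
  have "V \<sim> R m" using RV unfolding m_def by (rule prop2_sym)
  then have "V ** V ** V \<sim> R m ** R m ** R m" by (intro prop2_mult)
  also have "\<dots> \<sim> R (m ** m) ** R m"
    by (intro prop2_mult prop2_refl prop2_sym[OF R_mult[OF mS mS]])
  also have "\<dots> \<sim> R (m ** m ** m)"
    using R_mult[OF S_mult[OF mS mS] mS] by (rule prop2_sym)
  also have "\<dots> \<sim> mat 1" using \<open>m ** m ** m = mat 1\<close> R_one by simp
  finally have "V ** V ** V \<sim> mat 1" .
  moreover have "\<not> V \<sim> mat 1"
  proof
    assume "V \<sim> mat 1"
    then have "R m \<sim> mat 1" using RV prop2_trans unfolding m_def by blast
    then have "m \<sim> mat 1" using R_scalar mS by blast
    then show False by (simp add: m_def weyl_def unip_def mat2_prop2_1_iff)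
  qed
  ultimately have "(trace V)\<^sup>2 = det V" using \<open>det V \<noteq> 0\<close> by (intro cube_scalar)
  then have cc: "c * c = - a * a - b * c" unfolding detV by (simp add: V power2_eq_square)
  then have c: "c \<noteq> 0" using \<open>det V \<noteq> 0\<close> detV by auto
  \<comment> \<open>This \<open>x\<close> makes the diagonal entry \<open>a + x * c\<close> of the
    conjugate vanish; \<open>cc\<close> then makes the two remaining entries opposite.\<close>
  define x where "x = - (a / c)"
  have xc: "x * c = - a" using c by (simp add: x_def)
  have "b - 2 * (x * a) - x * (x * c) = - c"
  proof -
    have "c * (b - 2 * (x * a) - x * (x * c)) = b * c - 2 * (x * c) * a - (x * c) * (x * c)"
      by (simp add: algebra_simps)
    also have "\<dots> = b * c + a * a" unfolding xc by (simp add: algebra_simps)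
    also have "\<dots> = c * (- c)" by (simp add: cc)
    finally show ?thesis using c by (metis mult_left_cancel)
  qed
  note entry = this
  have "conj2 (unip x) (mat2 a b c (- a)) =
      mat2 (a + x * c) (b - 2 * (x * a) - x * (x * c)) c (- (x * c) - a)"
    by (simp add: conj2_def unip_def algebra_simps)
  also have "\<dots> = mat2 0 (- c) c 0" unfolding entry by (simp add: xc)
  also have "\<dots> = mat (- c) ** weyl" by (simp add: weyl_def)
  finally have "conj2 (unip x) (R weyl) = mat (- c) ** weyl" by (simp only: W d)
  then show ?thesis using c by (intro exI[of _ x]) simp
qed

lemma ex_normal: 
  "\<exists>P. det P \<noteq> 0 \<and> conj2 P (R (unip 1)) \<sim> unip 1 \<and> conj2 P (R weyl) \<sim> weyl"
proof -
  obtain P where P: "det P \<noteq> 0" "conj2 P (R (unip 1)) \<sim> unip 1" using ex_unip_normal by blast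
  interpret C: proj_rep p q e F S "\<lambda>A. conj2 P (R A)" by (rule conj[OF P(1)])
  obtain x where x: "conj2 (unip x) (conj2 P (R weyl)) \<sim> weyl" using C.ex_weyl_normal[OF P(2)] by blast
  have "conj2 (unip x) (conj2 P (R (unip 1))) \<sim> conj2 (unip x) (unip 1)"
    using P(2) by (rule conj2_prop2)
  also have "conj2 (unip x) (unip 1) = unip 1"
    by (simp add: conj2_def unip_def)
  finally show ?thesis using x P(1) unfolding conj2_conj2
    by (intro exI[of _ "unip x ** P"]) (simp add: det_mul unip_def)
qed

end

section \<open>Normalised representations and their field embedding\<close>

locale normal_proj_rep = proj_rep +
  assumes R_unip_1: "R (unip 1) \<sim> unip 1" and R_weyl: "R weyl \<sim> weyl"
begin

text \<open>The quotient of entries does not depend on the scalar by which \<open>R (unip t)\<close>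
  is chosen.\<close>

definition \<tau> :: "'a \<Rightarrow> 'a" where
  "\<tau> t = R (unip t) $ 1 $ 2 / R (unip t) $ 2 $ 2"

text \<open>The image commutes with \<open>unip 1\<close> up to a scalar, so
  \<open>intertwine_unip\<close> makes it triangular with equal diagonal entries.\<close>

lemma R_unip:
  assumes t: "t \<in> F"
  shows "R (unip t) \<sim> unip (\<tau> t)"
proof -
  obtain m n l k where M: "R (unip t) = mat2 m n l k" by (rule mat2_cases)
  have "R (unip t) ** unip 1 \<sim> R (unip t) ** R (unip 1)"
    by (rule prop2_mult[OF prop2_refl prop2_sym[OF R_unip_1]])
  also have "\<dots> \<sim> R (unip t ** unip 1)"
    by (rule prop2_sym[OF R_mult]) (use t in auto)
  also have "unip t ** unip 1 = unip 1 ** unip t" by (simp add: unip_mult add.commute)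
  also have "R \<dots> \<sim> R (unip 1) ** R (unip t)"
    by (rule R_mult) (use t in auto)
  also have "\<dots> \<sim> unip 1 ** R (unip t)"
    by (rule prop2_mult[OF R_unip_1 prop2_refl])
  finally have comm: "R (unip t) ** unip 1 \<sim> unip 1 ** R (unip t)" .
  have "l = 0" "m = k" "k \<noteq> 0"
    using intertwine_unip[OF comm R_det] t by (simp_all add: M)
  moreover have "\<tau> t = n / k" by (simp add: \<tau>_def M)
  ultimately have "R (unip t) = mat k ** unip (\<tau> t)"
    unfolding M by (simp add: unip_def)
  then show ?thesis using \<open>k \<noteq> 0\<close> by simp
qed

lemma tau_add:
  assumes "s \<in> F" "t \<in> F"
  shows "\<tau> (s + t) = \<tau> s + \<tau> t"
proof -
  have "unip (\<tau> (s + t)) \<sim> R (unip (s + t))" using assms by (intro prop2_sym[OF R_unip]) auto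
  also have "\<dots> \<sim> R (unip s) ** R (unip t)"
    using R_mult[of "unip s" "unip t"] assms by (simp add: unip_mult)
  also have "\<dots> \<sim> unip (\<tau> s) ** unip (\<tau> t)"
    using assms by (intro prop2_mult R_unip)
  finally show ?thesis by (simp add: unip_mult)
qed

lemma tau_1: "\<tau> 1 = 1"
proof -
  have "unip (\<tau> 1) \<sim> R (unip 1)" by (intro prop2_sym[OF R_unip]) simp
  also note R_unip_1
  finally show ?thesis by simp
qed

lemma tau_eq_0_iff: "t \<in> F \<Longrightarrow> \<tau> t = 0 \<longleftrightarrow> t = 0"
  using R_unip[of t] R_scalar[of "unip t"]
  by (metis prop2_sym prop2_trans unip_S unip_prop2_1_iff)

text \<open>The torus relation \<open>?D ** unip t = unip (x / y * t) ** ?D\<close> is transported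
  through \<open>R\<close> and read with \<open>intertwine_unip\<close>.\<close>

lemma R_diag_aux:
  assumes D: "mat2 x 0 0 y \<in> S" and t: "t \<in> F" "t \<noteq> 0"
  shows "R (mat2 x 0 0 y)$2$1 = 0"
    "R (mat2 x 0 0 y)$1$1 * \<tau> t = \<tau> (x / y * t) * R (mat2 x 0 0 y)$2$2"
    "R (mat2 x 0 0 y)$1$1 \<noteq> 0" "R (mat2 x 0 0 y)$2$2 \<noteq> 0"
proof -
  let ?D = "mat2 x 0 0 y"
  have xy: "x \<in> F" "y \<in> F" "x \<noteq> 0" "y \<noteq> 0" using sub_GL2[OF D] by auto
  have xt: "x / y * t \<in> F" "x / y * t \<noteq> 0" using xy t by auto
  have "R ?D ** unip (\<tau> t) \<sim> R ?D ** R (unip t)"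
    by (intro prop2_mult prop2_refl prop2_sym[OF R_unip] t)
  also have "\<dots> \<sim> R (?D ** unip t)" 
    using t by (intro prop2_sym[OF R_mult] D) auto
  also have "?D ** unip t = unip (x / y * t) ** ?D"
    using xy by (simp add: unip_def)
  also have "R \<dots> \<sim> R (unip (x / y * t)) ** R ?D"
    using xt by (intro R_mult D) auto
  also have "\<dots> \<sim> unip (\<tau> (x / y * t)) ** R ?D"
    by (intro prop2_mult prop2_refl R_unip xt)
  finally have *: "R ?D ** unip (\<tau> t) \<sim> unip (\<tau> (x / y * t)) ** R ?D" .
  have "\<tau> (x / y * t) \<noteq> 0" using xt tau_eq_0_iff by blast
  from intertwine_unip[OF * R_det[OF D] this]
  show "R (mat2 x 0 0 y)$2$1 = 0"
    "R (mat2 x 0 0 y)$1$1 * \<tau> t = \<tau> (x / y * t) * R (mat2 x 0 0 y)$2$2"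
    "R (mat2 x 0 0 y)$1$1 \<noteq> 0" "R (mat2 x 0 0 y)$2$2 \<noteq> 0" .
qed

text \<open>\<open>weyl\<close> conjugates \<open>?D\<close> to \<open>?D'\<close>. Both images are
  upper triangular, and conjugation by \<open>weyl\<close> exchanges upper and lower, so the
  off-diagonal entry \<open>n\<close> vanishes.\<close>

lemma R_diag:
  assumes D: "mat2 x 0 0 y \<in> S"
  shows "R (mat2 x 0 0 y) \<sim> mat2 (\<tau> (x / y)) 0 0 1"
proof -
  let ?D = "mat2 x 0 0 y"
  let ?D' = "mat2 y 0 0 x"
  have "mat2 0 (- 1) 1 0 \<in> S" by (rule SL2_sub) auto
  then have "weyl ** ?D ** mat2 0 (- 1) 1 0 \<in> S" using D by (intro S_mult weyl_S)
  then have D': "?D' \<in> S" by (simp add: weyl_def)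
  obtain m n l k where M: "R ?D = mat2 m n l k" by (rule mat2_cases)
  obtain m' n' l' k' where M': "R ?D' = mat2 m' n' l' k'" by (rule mat2_cases)
  have m: "l = 0" "m = \<tau> (x / y) * k" "k \<noteq> 0"
    using R_diag_aux[OF D one_F one_neq_zero] by (auto simp: M tau_1)
  have l': "l' = 0" using R_diag_aux(1)[OF D' one_F one_neq_zero] by (simp add: M')
  have "weyl ** R ?D \<sim> R weyl ** R ?D"
    by (intro prop2_mult prop2_refl prop2_sym[OF R_weyl])
  also have "\<dots> \<sim> R (weyl ** ?D)" by (intro prop2_sym[OF R_mult] weyl_S D)
  also have "weyl ** ?D = ?D' ** weyl" by (simp add: weyl_def)
  also have "R \<dots> \<sim> R ?D' ** R weyl" by (intro R_mult weyl_S D')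
  also have "\<dots> \<sim> R ?D' ** weyl" by (intro prop2_mult prop2_refl R_weyl)
  finally have "n = 0" by (auto simp: M M' weyl_def prop2_def l')
  then have "R ?D = mat k ** mat2 (\<tau> (x / y)) 0 0 1" using m by (simp add: M mult.commute)
  then show ?thesis using prop2_mat[OF \<open>k \<noteq> 0\<close>] by metis
qed

text \<open>Only the torus elements with entries \<open>a\<close> and \<open>inverse a\<close> are
  sure to lie in \<open>S\<close>, and these act on unipotents by \<open>a\<^sup>2\<close>. General
  factors come from differences of squares in \<open>tau_mult\<close>.\<close>

lemma tau_mult_square:
  assumes "a \<in> F" "t \<in> F"
  shows "\<tau> (a\<^sup>2 * t) = \<tau> (a\<^sup>2) * \<tau> t"
proof (cases "a = 0 \<or> t = 0")
  case True
  then show ?thesis using tau_eq_0_iff[of 0] by auto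
next
  case False
  then have "mat2 a 0 0 (inverse a) \<in> S" using assms by (intro SL2_sub) auto
  from R_diag_aux[OF this, of t] R_diag_aux[OF this, of 1] False assms tau_1
  show ?thesis by (simp add: power2_eq_square field_simps)
qed

lemma tau_diff: "s \<in> F \<Longrightarrow> t \<in> F \<Longrightarrow> \<tau> (s - t) = \<tau> s - \<tau> t"
  using tau_add[OF diff_F, of s t t] by simp

lemma tau_mult:
  assumes s: "s \<in> F" and t: "t \<in> F"
  shows "\<tau> (s * t) = \<tau> s * \<tau> t"
proof -
  obtain a b where ab: "a \<in> F" "b \<in> F" "s = a\<^sup>2 - b\<^sup>2" using square_diffE[OF s] .
  have "\<tau> (s * t) = \<tau> (a\<^sup>2 * t - b\<^sup>2 * t)" by (simp add: ab(3) algebra_simps)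
  also have "\<dots> = \<tau> (a\<^sup>2 * t) - \<tau> (b\<^sup>2 * t)" using ab t by (intro tau_diff) auto
  also have "\<dots> = (\<tau> (a\<^sup>2) - \<tau> (b\<^sup>2)) * \<tau> t"
    by (simp add: tau_mult_square ab t left_diff_distrib)
  also have "\<tau> (a\<^sup>2) - \<tau> (b\<^sup>2) = \<tau> s" unfolding ab(3) using ab by (intro tau_diff[symmetric]) auto
  finally show ?thesis .
qed

lemma theta_R_normal: "\<exists>j<e. \<forall>A\<in>S. theta (R A) = theta A ^ (p ^ j)"
proof -
  obtain j where j: "j < e" "\<And>x. x \<in> F \<Longrightarrow> \<tau> x = x ^ (p ^ j)"
    using field_hom_eq_frob[of \<tau>] tau_add tau_mult tau_1 by blast
  define r where "r = p ^ j"
  have tau: "\<tau> x = x ^ r" if "x \<in> F" for x using j(2)[OF that] by (simp add: r_def)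
  have add: "x ^ r + y ^ r = (x + y) ^ r" for x y :: 'a by (simp add: r_def frob_add)
  have sq: "(x ^ r)\<^sup>2 = (x\<^sup>2) ^ r" for x :: 'a by (metis power_mult mult.commute)
  have theta: "theta (R A) = theta A ^ r" if A: "A \<in> S" for A
  proof -
    obtain a b c d where A_eq: "A = mat2 a b c d" by (rule mat2_cases)
    have F: "a \<in> F" "b \<in> F" "c \<in> F" "d \<in> F" and nz: "a * d - b * c \<noteq> 0"
      using sub_GL2 A by (auto simp: A_eq)
    show ?thesis
    proof (cases "c = 0")
      case True
      then have ad: "a \<noteq> 0" "d \<noteq> 0" using nz by auto
      have bd: "b / d \<in> F" "a / d \<in> F" using F by auto
      have "unip (- (b / d)) ** A \<in> S" using A bd by (intro S_mult unip_S uminus_F)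
      then have D: "mat2 a 0 0 d \<in> S" using True ad by (simp add: A_eq unip_def)
      have "A = unip (b / d) ** mat2 a 0 0 d" using True ad by (simp add: A_eq unip_def)
      then have "R A \<sim> R (unip (b / d)) ** R (mat2 a 0 0 d)"
        using R_mult[OF unip_S D] bd by simp
      also have "\<dots> \<sim> unip (\<tau> (b / d)) ** mat2 (\<tau> (a / d)) 0 0 1"
        by (intro prop2_mult R_unip R_diag D bd)
      finally have "theta (R A) = ((a / d) ^ r + 1) ^ 2 / (a / d) ^ r"
        by (auto dest!: theta_prop2 simp: unip_def theta_mat2 tau bd)
      also have "\<dots> = (((a / d) + 1)\<^sup>2 / (a / d)) ^ r"
        using add[of "a / d" 1] by (simp only: power_one sq power_divide)
      also have "((a / d) + 1)\<^sup>2 / (a / d) = theta A"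
        using ad True by (simp add: A_eq theta_mat2 power2_eq_square field_simps)
      finally show ?thesis .
    next
      case False
      \<comment> \<open>On the big Bruhat cell, \<open>A\<close> is
        \<open>unip (a / c) ** weyl ** ?D ** unip (d / c)\<close>. The factor \<open>?D\<close> lies
        in \<open>S\<close> because the other factors have inverses there,
        \<open>mat2 0 (- 1) 1 0\<close> being that of \<open>weyl\<close>.\<close>
      define \<delta> where "\<delta> = a * d - b * c"
      have \<delta>: "\<delta> \<noteq> 0" "\<delta> \<in> F" using nz F by (auto simp: \<delta>_def)
      have in_F: "a / c \<in> F" "d / c \<in> F" "c\<^sup>2 / \<delta> \<in> F" using F \<delta> by auto
      let ?D = "mat2 (- c) 0 0 (- \<delta> / c)"
      have "mat2 0 (- 1) 1 0 \<in> S" by (rule SL2_sub) auto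
      then have "mat2 0 (- 1) 1 0 ** unip (- (a / c)) ** A ** unip (- (d / c)) \<in> S"
        using A in_F by (intro S_mult unip_S uminus_F)
      moreover have "mat2 0 (- 1) 1 0 ** unip (- (a / c)) ** A ** unip (- (d / c)) = ?D"
        using False by (simp add: A_eq unip_def \<delta>_def field_simps)
      ultimately have D: "?D \<in> S" by simp
      have A': "A = unip (a / c) ** weyl ** ?D ** unip (d / c)"
        using False by (simp add: A_eq unip_def weyl_def \<delta>_def field_simps)
      have S1: "unip (a / c) ** weyl \<in> S" and S2: "unip (a / c) ** weyl ** ?D \<in> S"
        using in_F D by (auto intro!: S_mult)
      have "R A \<sim> R (unip (a / c) ** weyl ** ?D) ** R (unip (d / c))"
        unfolding A' by (intro R_mult S2 unip_S in_F)
      also have "\<dots> \<sim> R (unip (a / c) ** weyl) ** R ?D ** R (unip (d / c))"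
        by (intro prop2_mult prop2_refl R_mult S1 D)
      also have "\<dots> \<sim> R (unip (a / c)) ** R weyl ** R ?D ** R (unip (d / c))"
        by (intro prop2_mult prop2_refl R_mult unip_S weyl_S in_F)
      also have "\<dots> \<sim> unip (\<tau> (a / c)) ** weyl ** mat2 (\<tau> (- c / (- \<delta> / c))) 0 0 1 ** unip (\<tau> (d / c))"
        by (intro prop2_mult R_unip R_weyl R_diag D in_F)
      also have "- c / (- \<delta> / c) = c\<^sup>2 / \<delta>" using False by (simp add: power2_eq_square)
      finally have "R A \<sim> unip ((a / c) ^ r) ** weyl ** mat2 ((c\<^sup>2 / \<delta>) ^ r) 0 0 1 ** unip ((d / c) ^ r)"
        by (simp only: tau in_F)
      then have "theta (R A) = (- ((a / c) ^ r * (c\<^sup>2 / \<delta>) ^ r) - (c\<^sup>2 / \<delta>) ^ r * (d / c) ^ r)\<^sup>2 / (c\<^sup>2 / \<delta>) ^ r"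
        by (auto dest!: theta_prop2 simp: unip_def weyl_def theta_mat2 algebra_simps)
      also have "\<dots> = ((a / c) ^ r + (d / c) ^ r)\<^sup>2 * (c\<^sup>2 / \<delta>) ^ r"
        using False \<delta> by (simp add: power2_eq_square field_simps)
      also have "\<dots> = ((a / c + d / c)\<^sup>2 * (c\<^sup>2 / \<delta>)) ^ r"
        unfolding add by (simp only: power_mult_distrib sq)
      also have "(a / c + d / c)\<^sup>2 * (c\<^sup>2 / \<delta>) = theta A"
        using False by (simp add: A_eq theta_mat2 \<delta>_def power2_eq_square flip: add_divide_distrib)
      finally show ?thesis .
    qed
  qed
  show ?thesis using j(1) theta by (auto simp: r_def)
qed

end

theorem (in proj_rep) theta_R: "\<exists>j<e. \<forall>A\<in>S. theta (R A) = theta A ^ (p ^ j)"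
proof -
  obtain P where P: "det P \<noteq> 0" "conj2 P (R (unip 1)) \<sim> unip 1" "conj2 P (R weyl) \<sim> weyl"
    using ex_normal by blast
  interpret C: proj_rep p q e F S "\<lambda>A. conj2 P (R A)" by (rule conj[OF P(1)])
  interpret N: normal_proj_rep p q e F S "\<lambda>A. conj2 P (R A)"
    by unfold_locales (use P in auto)
  show ?thesis using N.theta_R_normal by (simp add: theta_conj2 P(1))
qed

subsection \<open>Matrix groups modulo scalars\<close>

text \<open>A subgroup of \<open>GL(2)\<close> given by its matrices. The instances are
  \<open>GL2\<close> and \<open>SL2\<close> over a subfield and \<open>GL2\<close> over the whole
  field, so cosets modulo scalars are handled once.\<close>

locale matrix_group =
  fixes C :: "('a::field^2^2) set"
  assumes det_C: "A \<in> C \<Longrightarrow> det A \<noteq> 0"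
    and one_C [simp]: "mat 1 \<in> C"
    and mult_C: "A \<in> C \<Longrightarrow> B \<in> C \<Longrightarrow> A ** B \<in> C"
    and inverse_C: "A \<in> C \<Longrightarrow> mat (inverse (det A)) ** adj2 A \<in> C"
begin

definition GC :: "('a^2^2) monoid" where
  "GC = \<lparr>carrier = C, monoid.mult = (**), monoid.one = mat 1\<rparr>"

definition ZC :: "('a^2^2) set" where "ZC = {A \<in> C. A \<sim> mat 1}"

definition cls :: "'a^2^2 \<Rightarrow> ('a^2^2) set" where "cls A = ZC #>\<^bsub>GC\<^esub> A"

lemma inverse_mult:
  assumes "A \<in> C"
  shows "(mat (inverse (det A)) ** adj2 A) ** A = mat 1" "A ** (mat (inverse (det A)) ** adj2 A) = mat 1"
proof -
  have "(mat (inverse (det A)) ** adj2 A) ** A = mat (inverse (det A)) ** (adj2 A ** A)"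
    by (simp add: matrix_mul_assoc)
  then show "(mat (inverse (det A)) ** adj2 A) ** A = mat 1"
    using det_C[OF assms] by (simp add: adj2_mult mat_mult_mat)
  then show "A ** (mat (inverse (det A)) ** adj2 A) = mat 1"
    using matrix_left_right_inverse by blast
qed

lemma group_GC: "group GC"
proof (rule groupI)
  show "\<exists>y\<in>carrier GC. y \<otimes>\<^bsub>GC\<^esub> x = \<one>\<^bsub>GC\<^esub>" if "x \<in> carrier GC" for x
    using that inverse_C inverse_mult(1) by (auto simp: GC_def)
qed (auto simp: GC_def mult_C matrix_mul_assoc)

sublocale GC: group GC by (rule group_GC)

lemma inv_GC: "A \<in> C \<Longrightarrow> inv\<^bsub>GC\<^esub> A = mat (inverse (det A)) ** adj2 A"
  by (rule GC.inv_equality) (simp_all add: GC_def inverse_C inverse_mult)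

lemma normal_ZC: "ZC \<lhd> GC"
proof -
  have "subgroup ZC GC"
  proof (rule GC.subgroupI)
    show "ZC \<noteq> {}" by (auto simp: ZC_def intro!: exI[of _ "mat 1"])
    show "inv\<^bsub>GC\<^esub> A \<in> ZC" if A: "A \<in> ZC" for A
    proof -
      have "inv\<^bsub>GC\<^esub> A \<sim> inv\<^bsub>GC\<^esub> A ** A"
        using prop2_mult[OF prop2_refl prop2_sym] A by (metis (no_types, lifting) ZC_def mem_Collect_eq matrix_mul_rid)
      then show ?thesis using A by (auto simp: ZC_def inv_GC inverse_C inverse_mult)
    qed
    show "A \<otimes>\<^bsub>GC\<^esub> B \<in> ZC" if "A \<in> ZC" "B \<in> ZC" for A B
      using that prop2_mult[of A "mat 1" B "mat 1"] by (auto simp: ZC_def GC_def mult_C)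
  qed (auto simp: ZC_def GC_def)
  moreover have "x \<otimes>\<^bsub>GC\<^esub> h \<otimes>\<^bsub>GC\<^esub> inv\<^bsub>GC\<^esub> x \<in> ZC" if x: "x \<in> carrier GC" and h: "h \<in> ZC" for x h
  proof -
    have "x \<otimes>\<^bsub>GC\<^esub> h = h \<otimes>\<^bsub>GC\<^esub> x"
      using h by (auto simp: GC_def ZC_def prop2_mat_1_iff mat_mult_commute)
    moreover have "h \<in> carrier GC" using h by (auto simp: ZC_def GC_def)
    ultimately have "x \<otimes>\<^bsub>GC\<^esub> h \<otimes>\<^bsub>GC\<^esub> inv\<^bsub>GC\<^esub> x = h" using x by (simp add: GC.m_assoc)
    then show ?thesis using h by simp
  qed
  ultimately show ?thesis using GC.normal_inv_iff by blast
qed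

sublocale ZC: normal ZC GC by (rule normal_ZC)

lemma group_Mod: "group (GC Mod ZC)"
  by (rule ZC.factorgroup_is_group)

lemma carrier_Mod: "carrier (GC Mod ZC) = cls ` C"
  by (auto simp: FactGroup_def RCOSETS_def cls_def GC_def)

lemma cls_mult: "A \<in> C \<Longrightarrow> B \<in> C \<Longrightarrow> cls A \<otimes>\<^bsub>GC Mod ZC\<^esub> cls B = cls (A ** B)"
  using ZC.rcos_sum[of A B] by (simp add: FactGroup_def cls_def GC_def)

lemma cls_eq_iff:
  assumes A: "A \<in> C" and B: "B \<in> C"
  shows "cls A = cls B \<longleftrightarrow> A \<sim> B"
proof
  assume "cls A = cls B"
  moreover have "A \<in> cls A" unfolding cls_def
    using A by (intro GC.rcos_self ZC.subgroup_axioms) (simp add: GC_def)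
  ultimately obtain h where "h \<in> ZC" "A = h ** B"
    by (auto simp: cls_def r_coset_def GC_def)
  then show "A \<sim> B" using prop2_mult[of h "mat 1" B B] by (simp add: ZC_def)
next
  assume "A \<sim> B"
  then obtain c where c: "c \<noteq> 0" "A = mat c ** B" by (auto simp: prop2_def)
  \<comment> \<open>\<open>C\<close> need not contain every scalar matrix; this one lies in
    \<open>C\<close> as the quotient of \<open>A\<close> and \<open>B\<close>.\<close>
  have "A ** (mat (inverse (det B)) ** adj2 B) = mat c ** (B ** (mat (inverse (det B)) ** adj2 B))"
    by (simp add: c matrix_mul_assoc)
  then have "mat c = A ** (mat (inverse (det B)) ** adj2 B)" using inverse_mult[OF B] by simp
  then have "mat c \<in> C" using mult_C[OF A inverse_C[OF B]] by (simp only:)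
  then have "mat c \<in> ZC" using c by (auto simp: ZC_def prop2_mat_1_iff)
  then have "A \<in> cls B" using c by (auto simp: cls_def r_coset_def GC_def)
  then show "cls A = cls B" unfolding cls_def
    using GC.repr_independence[of A ZC B] B ZC.subgroup_axioms by (simp add: GC_def)
qed

lemma one_Mod: "\<one>\<^bsub>GC Mod ZC\<^esub> = cls (mat 1)"
  using GC.coset_join2[of "mat 1" ZC] ZC.subgroup_axioms
  by (simp add: FactGroup_def cls_def GC_def ZC_def)

end

section \<open>Linear groups over a subfield and \<open>PGL(2, K)\<close> as instances\<close>

lemma matrix_mult_nth_2: "(A ** B) $ i $ j = A $ i $ 1 * B $ 1 $ j + A $ i $ 2 * B $ 2 $ j"
  for A B :: "'a::comm_ring_1^2^2"
  by (simp add: matrix_matrix_mult_def sum_2)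

lemma mat_nth: "mat c $ i $ j = (if i = j then c else 0)"
  by (simp add: mat_def)

lemma adj2_nth: "adj2 A $ 1 $ 1 = A $ 2 $ 2" "adj2 A $ 1 $ 2 = - A $ 1 $ 2"
  "adj2 A $ 2 $ 1 = - A $ 2 $ 1" "adj2 A $ 2 $ 2 = A $ 1 $ 1"
  by (simp_all add: adj2_def)

lemma GL2_iff: "A \<in> carrier (GL2 F) \<longleftrightarrow> (\<forall>i j. A $ i $ j \<in> F) \<and> det A \<noteq> 0"
  by (simp add: GL2_def)

lemma SL2_iff: "A \<in> carrier (SL2 F) \<longleftrightarrow> (\<forall>i j. A $ i $ j \<in> F) \<and> det A = 1"
  by (simp add: SL2_def)

lemma matrix_group_GL2:
  assumes F: "0 \<in> F" "1 \<in> F" "\<And>x y. x \<in> F \<Longrightarrow> y \<in> F \<Longrightarrow> x - y \<in> F"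
    "\<And>x y. x \<in> F \<Longrightarrow> y \<in> F \<Longrightarrow> x * y \<in> F" "\<And>x. x \<in> F \<Longrightarrow> inverse x \<in> F"
  shows "matrix_group (carrier (GL2 (F :: 'a::field set)))" "matrix_group (carrier (SL2 F))"
    and "PGL2 F = matrix_group.GC (carrier (GL2 F)) Mod matrix_group.ZC (carrier (GL2 F))"
    and "PSL2 F = matrix_group.GC (carrier (SL2 F)) Mod matrix_group.ZC (carrier (SL2 F))"
proof -
  have neg: "- x \<in> F" if "x \<in> F" for x using F(3)[OF F(1) that] by simp
  have add: "x + y \<in> F" if "x \<in> F" "y \<in> F" for x y using F(3)[OF that(1) neg[OF that(2)]] by simp
  have inv: "inverse (det A) \<in> F" if "A $ 1 $ 1 \<in> F" "A $ 1 $ 2 \<in> F" "A $ 2 $ 1 \<in> F" "A $ 2 $ 2 \<in> F"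
    for A :: "'a^2^2"
    using that by (auto simp: det_2 intro!: F)
  show GL: "matrix_group (carrier (GL2 F))"
    using inv by unfold_locales
      (auto simp: GL2_iff det_mul mat_nth matrix_mult_nth_2 forall_2 adj2_nth F add neg)
  show SL: "matrix_group (carrier (SL2 F))"
    by unfold_locales
      (auto simp: SL2_iff det_mul mat_nth matrix_mult_nth_2 forall_2 adj2_nth F add neg)
  interpret GL: matrix_group "carrier (GL2 F)" by (rule GL)
  interpret SL: matrix_group "carrier (SL2 F)" by (rule SL)
  have sc: "A \<sim> mat 1 \<longleftrightarrow> A \<in> scalars F" if "A $ 1 $ 1 \<in> F" for A
    using that by (auto simp: prop2_mat_1_iff scalars_def mat_nth)
  have scF: "A \<in> carrier (GL2 F)" if "A \<in> scalars F" for A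
    using that by (auto simp: scalars_def GL2_iff mat_nth F)
  have "scalars F = GL.ZC"
    using sc scF by (auto simp: GL.ZC_def GL2_iff)
  moreover have "GL.GC = GL2 F" by (simp add: GL.GC_def) (simp add: GL2_def)
  ultimately show "PGL2 F = GL.GC Mod GL.ZC" by (simp add: PGL2_def)
  have "scalars F \<inter> carrier (SL2 F) = SL.ZC"
    using sc by (auto simp: SL.ZC_def SL2_iff)
  moreover have "SL.GC = SL2 F" by (simp add: SL.GC_def) (simp add: SL2_def)
  ultimately show "PSL2 F = SL.GC Mod SL.ZC" by (simp add: PSL2_def)
qed

interpretation GLU: matrix_group "carrier (GL2 (UNIV :: 'a::field set))"
  by (rule matrix_group_GL2) auto

lemma PGL2_UNIV: "PGL2 (UNIV :: 'a::field set) = GLU.GC Mod GLU.ZC"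
  by (rule matrix_group_GL2) auto

lemma GL2_UNIV_iff: "A \<in> carrier (GL2 UNIV) \<longleftrightarrow> det A \<noteq> 0"
  by (simp add: GL2_iff)

lemma proj_class_eq_cls: "proj_class A = GLU.cls A" for A :: "'a::field^2^2"
proof -
  have "scalars (UNIV :: 'a set) = GLU.ZC"
    by (auto simp: scalars_def GLU.ZC_def prop2_mat_1_iff GL2_UNIV_iff)
  moreover have "GLU.GC = GL2 (UNIV :: 'a set)" by (simp add: GLU.GC_def) (simp add: GL2_def)
  ultimately show ?thesis by (simp add: proj_class_def GLU.cls_def)
qed

lemma group_PGL2_UNIV: "group (PGL2 (UNIV :: 'a::field set))"
  unfolding PGL2_UNIV by (rule GLU.group_Mod)

lemma carrier_PGL2_UNIV: "carrier (PGL2 UNIV) = proj_class ` {A. det A \<noteq> 0}"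
  unfolding PGL2_UNIV GLU.carrier_Mod proj_class_eq_cls[abs_def] by (auto simp: GL2_UNIV_iff)

lemma proj_class_mult:
  "det A \<noteq> 0 \<Longrightarrow> det B \<noteq> 0 \<Longrightarrow> proj_class A \<otimes>\<^bsub>PGL2 UNIV\<^esub> proj_class B = proj_class (A ** B)"
  unfolding PGL2_UNIV proj_class_eq_cls by (rule GLU.cls_mult) (simp_all add: GL2_UNIV_iff)

lemma proj_class_eq_iff:
  "det A \<noteq> 0 \<Longrightarrow> det B \<noteq> 0 \<Longrightarrow> (proj_class A = proj_class B) = (A \<sim> B)"
  unfolding proj_class_eq_cls by (rule GLU.cls_eq_iff) (simp_all add: GL2_UNIV_iff)

lemma one_PGL2_UNIV: "\<one>\<^bsub>PGL2 UNIV\<^esub> = proj_class (mat 1)"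
  unfolding PGL2_UNIV proj_class_eq_cls by (rule GLU.one_Mod)

text \<open>An arbitrary matrix in the class; what is read off from it, such as
  \<open>theta\<close>, has to be invariant under scalars.\<close>

definition repr :: "('a::field^2^2) set \<Rightarrow> 'a^2^2" where
  "repr g = (SOME A. det A \<noteq> 0 \<and> proj_class A = g)"

lemma repr:
  assumes "g \<in> carrier (PGL2 UNIV)"
  shows "det (repr g) \<noteq> 0" "proj_class (repr g) = g"
proof -
  have "\<exists>A. det A \<noteq> 0 \<and> proj_class A = g" using assms by (auto simp: carrier_PGL2_UNIV)
  then have "det (repr g) \<noteq> 0 \<and> proj_class (repr g) = g" unfolding repr_def by (rule someI_ex)
  then show "det (repr g) \<noteq> 0" "proj_class (repr g) = g" by auto
qed

lemma repr_proj_class: "det A \<noteq> 0 \<Longrightarrow> repr (proj_class A) \<sim> A"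
  using repr[of "proj_class A"] proj_class_eq_iff by (auto simp: carrier_PGL2_UNIV)

lemma theta_repr: "det A \<noteq> 0 \<Longrightarrow> theta (repr (proj_class A)) = theta A"
  by (rule theta_prop2[OF repr_proj_class])

lemma (in finite_subfield) matrix_group_F:
  shows "matrix_group (carrier (GL2 F))" "matrix_group (carrier (SL2 F))"
    and "PGL2 F = matrix_group.GC (carrier (GL2 F)) Mod matrix_group.ZC (carrier (GL2 F))"
    and "PSL2 F = matrix_group.GC (carrier (SL2 F)) Mod matrix_group.ZC (carrier (SL2 F))"
  using matrix_group_GL2[of F] by auto

text \<open>The cases \<open>C = SL2 F\<close> and \<open>C = GL2 F\<close> give \<open>PSL2 F\<close> and \<open>PGL2 F\<close>.\<close>

locale linear_group = finite_subfield p q e F + matrix_group C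
  for p q e and F :: "'a::alg_closed_field set" and C :: "('a^2^2) set" +
  assumes SL2_C: "carrier (SL2 F) \<subseteq> C" and C_GL2: "C \<subseteq> carrier (GL2 F)"
begin

lemma theta_F:
  assumes "A \<in> C"
  shows "theta A \<in> F"
proof -
  obtain a b c d where A: "A = mat2 a b c d" by (rule mat2_cases)
  have "a \<in> F" "b \<in> F" "c \<in> F" "d \<in> F"
    using assms C_GL2 A by (auto simp: GL2_iff forall_2)
  then show ?thesis by (auto simp: A theta_mat2)
qed

text \<open>Choosing representatives of the images turns \<open>h\<close> into a map of matrices;
  injectivity of \<open>h\<close> becomes the condition \<open>R_scalar\<close> on the
  kernel.\<close>

lemma proj_rep_hom:
  assumes hom: "h \<in> hom (GC Mod ZC) (PGL2 UNIV)" and inj: "inj_on h (carrier (GC Mod ZC))"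
  shows "proj_rep p q e F C (\<lambda>A. repr (h (cls A)))"
proof (intro proj_rep.intro proj_rep_axioms.intro finite_subfield_axioms)
  show "mat2 a b c d \<in> C" if "a \<in> F" "b \<in> F" "c \<in> F" "d \<in> F" "a * d - b * c = 1" for a b c d
    using that SL2_C by (auto simp: SL2_iff forall_2)
  show "a \<in> F \<and> b \<in> F \<and> c \<in> F \<and> d \<in> F \<and> a * d - b * c \<noteq> 0" if "mat2 a b c d \<in> C" for a b c d
    using that C_GL2 det_C[OF that] by (auto simp: GL2_iff forall_2)
  have carr: "h (cls A) \<in> carrier (PGL2 UNIV)" if "A \<in> C" for A
    using hom that by (auto simp: hom_def carrier_Mod)
  fix A B assume A: "A \<in> C"
  show "det (repr (h (cls A))) \<noteq> 0" using repr carr[OF A] by blast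
  interpret group_hom "GC Mod ZC" "PGL2 UNIV" h
    using hom by (simp add: group_hom_def group_hom_axioms_def group_Mod group_PGL2_UNIV)
  have "repr (h (cls A)) \<sim> mat 1 \<longleftrightarrow> proj_class (repr (h (cls A))) = proj_class (mat 1)"
    using repr(1)[OF carr[OF A]] by (simp add: proj_class_eq_iff)
  also have "\<dots> \<longleftrightarrow> h (cls A) = h (cls (mat 1))"
    using repr(2)[OF carr[OF A]] hom_one[unfolded one_Mod one_PGL2_UNIV] by (simp only:)
  also have "\<dots> \<longleftrightarrow> cls A = cls (mat 1)"
    using inj A by (auto simp: carrier_Mod inj_on_eq_iff)
  also have "\<dots> \<longleftrightarrow> A \<sim> mat 1" using A by (simp add: cls_eq_iff)
  finally show "repr (h (cls A)) \<sim> mat 1 \<longleftrightarrow> A \<sim> mat 1" .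
  assume B: "B \<in> C"
  show "A ** B \<in> C" using A B by (rule mult_C)
  have "proj_class (repr (h (cls (A ** B)))) = h (cls A) \<otimes>\<^bsub>PGL2 UNIV\<^esub> h (cls B)"
    using repr(2)[OF carr[OF mult_C[OF A B]]] hom_mult[of "cls A" "cls B", unfolded cls_mult[OF A B]] A B
    by (simp add: carrier_Mod)
  also have "\<dots> = proj_class (repr (h (cls A)) ** repr (h (cls B)))"
    using repr[OF carr[OF A]] repr[OF carr[OF B]] by (metis proj_class_mult)
  finally show "repr (h (cls (A ** B))) \<sim> repr (h (cls A)) ** repr (h (cls B))"
    using repr(1)[OF carr[OF A]] repr(1)[OF carr[OF B]] repr(1)[OF carr[OF mult_C[OF A B]]]
    by (simp add: proj_class_eq_iff det_mul)
qed

lemma theta_hom: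
  assumes hom: "h \<in> hom (GC Mod ZC) (PGL2 UNIV)" and inj: "inj_on h (carrier (GC Mod ZC))"
  shows "\<exists>j<e. \<forall>A\<in>C. theta (repr (h (cls A))) = theta A ^ (p ^ j)"
  using proj_rep.theta_R[OF proj_rep_hom[OF assms]] .

text \<open>A companion matrix of determinant \<open>1\<close> realises any trace \<open>t\<close>.
  Squares suffice later, since their differences fill \<open>F\<close>.\<close>

lemma square_eq_theta: "t \<in> F \<Longrightarrow> \<exists>A\<in>C. theta A = t\<^sup>2"
proof -
  assume t: "t \<in> F"
  have "mat2 t (-1) 1 0 \<in> carrier (SL2 F)"
    using t uminus_F[OF one_F] by (simp add: SL2_iff forall_2)
  moreover have "theta (mat2 t (-1) 1 0) = t\<^sup>2" by (simp add: theta_mat2)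
  ultimately show ?thesis using SL2_C by blast
qed

section \<open>Invariants and involutory automorphisms of a subgroup \<open>H\<close>\<close>

context
  fixes H :: "('a^2^2) set set"
  assumes sub: "subgroup H (PGL2 UNIV)"
    and iso: "(PGL2 UNIV)\<lparr>carrier := H\<rparr> \<cong> GC Mod ZC"
begin

interpretation K: group "PGL2 (UNIV :: 'a set)" by (rule group_PGL2_UNIV)

lemma ex_hom_onto:
  "\<exists>h. h \<in> hom (GC Mod ZC) (PGL2 UNIV) \<and> inj_on h (carrier (GC Mod ZC)) \<and> h ` carrier (GC Mod ZC) = H"
proof -
  have "group ((PGL2 UNIV)\<lparr>carrier := H\<rparr>)" using sub by (rule subgroup.subgroup_is_group) (rule group_PGL2_UNIV)
  then have "GC Mod ZC \<cong> (PGL2 UNIV)\<lparr>carrier := H\<rparr>" using iso by (rule group.iso_sym)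
  then obtain h where "h \<in> iso (GC Mod ZC) ((PGL2 UNIV)\<lparr>carrier := H\<rparr>)" by (auto simp: is_iso_def)
  then show ?thesis using subgroup.subset[OF sub] by (auto simp: iso_iff hom_def)
qed

text \<open>\<open>H\<close> is only abstractly isomorphic to the linear group, so its matrices may
  have entries outside \<open>F\<close>. The invariants remain in \<open>F\<close>, being Frobenius
  powers of invariants of elements of \<open>C\<close>.\<close>

lemma theta_subgroup_F:
  assumes "g \<in> H"
  shows "theta (repr g) \<in> F"
proof -
  obtain h where h: "h \<in> hom (GC Mod ZC) (PGL2 UNIV)" "inj_on h (carrier (GC Mod ZC))"
    "h ` carrier (GC Mod ZC) = H" using ex_hom_onto by blast
  obtain A where "A \<in> C" "g = h (cls A)" using h(3) assms by (auto simp: carrier_Mod)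
  moreover from this have "theta A \<in> F" by (simp add: theta_F)
  ultimately show ?thesis using theta_hom[OF h(1,2)] by (auto intro: power_F)
qed

theorem theta_involutory_automorphism:
  assumes f: "f \<in> iso ((PGL2 UNIV)\<lparr>carrier := H\<rparr>) ((PGL2 UNIV)\<lparr>carrier := H\<rparr>)"
    and inv: "\<And>g. g \<in> H \<Longrightarrow> f (f g) = g"
  shows "\<exists>d. (d = 0 \<or> 2 * d = e) \<and> (\<forall>g\<in>H. theta (repr (f g)) = theta (repr g) ^ (p ^ d))"
proof -
  obtain h where h: "h \<in> hom (GC Mod ZC) (PGL2 UNIV)" "inj_on h (carrier (GC Mod ZC))"
    "h ` carrier (GC Mod ZC) = H" using ex_hom_onto by blast
  obtain j where j: "j < e" "\<And>A. A \<in> C \<Longrightarrow> theta (repr (h (cls A))) = theta A ^ (p ^ j)"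
    using theta_hom[OF h(1,2)] by blast
  have "f \<circ> h \<in> hom (GC Mod ZC) (PGL2 UNIV)"
    using h f subgroup.subset[OF sub] by (auto simp: hom_def iso_def Pi_def)
  moreover have "inj_on (f \<circ> h) (carrier (GC Mod ZC))"
    using h(2,3) f by (intro comp_inj_on) (auto simp: iso_iff)
  ultimately obtain i where i: "i < e" "\<And>A. A \<in> C \<Longrightarrow> theta (repr (f (h (cls A)))) = theta A ^ (p ^ i)"
    using theta_hom[of "f \<circ> h"] by auto
  have fH: "f g \<in> H" if "g \<in> H" for g using f that by (auto simp: iso_def hom_def)
  have pow: "theta (repr (f g)) ^ (p ^ j) = theta (repr g) ^ (p ^ i)" if g: "g \<in> H" for g
  proof -
    obtain A where A: "A \<in> C" "g = h (cls A)" using h(3) g by (auto simp: carrier_Mod)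
    show ?thesis using i(2)[OF A(1)] j(2)[OF A(1)] by (simp add: A(2) mult.commute flip: power_mult)
  qed
  \<comment> \<open>Powers of Frobenius are injective, so a common one can be cancelled.\<close>
  have shift: "x = y ^ (p ^ (m - n))" if "x ^ (p ^ n) = y ^ (p ^ m)" "n \<le> m" for x y :: 'a and m n
  proof -
    have "y ^ (p ^ m) = (y ^ (p ^ (m - n))) ^ (p ^ n)"
      using that(2) by (simp flip: power_mult power_add)
    then show ?thesis using that(1) frob_eq_iff by metis
  qed
  obtain d where d: "d < e" "\<And>g. g \<in> H \<Longrightarrow> theta (repr (f g)) = theta (repr g) ^ (p ^ d)"
  proof (cases "j \<le> i")
    case True
    show ?thesis by (rule that[of "i - j"]) (use i(1) shift[OF pow True] in auto)
  next
    case False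
    \<comment> \<open>When \<open>j > i\<close>, the relation \<open>pow\<close> is applied to
      \<open>f g\<close>; since \<open>f\<close> is an involution, the two sides change roles and
      the exponent difference becomes positive.\<close>
    have "theta (repr (f g)) = theta (repr g) ^ (p ^ (j - i))" if g: "g \<in> H" for g
      using shift[of "theta (repr (f g))" i "theta (repr g)" j] pow[OF fH[OF g]] False by (simp add: inv g)
    then show ?thesis using that[of "j - i"] j(1) by auto
  qed
  have H_fixed: "theta (repr g) ^ (p ^ (2 * d)) = theta (repr g)" if g: "g \<in> H" for g
  proof -
    have "theta (repr g) = (theta (repr g) ^ (p ^ d)) ^ (p ^ d)"
      using d(2)[OF fH[OF g]] d(2)[OF g] by (simp add: inv g)
    then show ?thesis by (simp add: mult_2 power_add flip: power_mult)
  qed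
  \<comment> \<open>The invariants of \<open>H\<close> include the \<open>p ^ j\<close>-th powers of
    all squares of \<open>F\<close>; cancelling that power shows that the squares themselves are
    fixed.\<close>
  have sq_fixed: "(t\<^sup>2) ^ (p ^ (2 * d)) = t\<^sup>2" if t: "t \<in> F" for t
  proof -
    obtain A where A: "A \<in> C" "theta A = t\<^sup>2" using square_eq_theta[OF t] by blast
    have "h (cls A) \<in> H" using h(3) A by (auto simp: carrier_Mod)
    then have "((t\<^sup>2) ^ (p ^ j)) ^ (p ^ (2 * d)) = (t\<^sup>2) ^ (p ^ j)"
      using H_fixed[of "h (cls A)"] j(2)[OF A(1)] A(2) by simp
    then have "((t\<^sup>2) ^ (p ^ (2 * d))) ^ (p ^ j) = (t\<^sup>2) ^ (p ^ j)"
      by (metis power_mult mult.commute)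
    then show ?thesis by (simp only: frob_eq_iff)
  qed
  have "x ^ (p ^ (2 * d)) = x" if x: "x \<in> F" for x
  proof -
    obtain a b where ab: "a \<in> F" "b \<in> F" "x = a\<^sup>2 - b\<^sup>2" using square_diffE[OF x] .
    then show ?thesis by (simp only: frob_diff sq_fixed)
  qed
  from frob_square_trivial[OF this d(1)] d(2) show ?thesis by blast
qed

end

end

lemma (in finite_subfield) linear_group_GL2: "linear_group p q e F (carrier (GL2 F))"
  by (intro linear_group.intro finite_subfield_axioms matrix_group_F linear_group_axioms.intro)
     (auto simp: GL2_iff SL2_iff)

lemma (in finite_subfield) linear_group_SL2: "linear_group p q e F (carrier (SL2 F))"
  by (intro linear_group.intro finite_subfield_axioms matrix_group_F linear_group_axioms.intro)
     (auto simp: GL2_iff SL2_iff)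

subsection \<open>Orders in the projective group\<close>

lemma (in group) ord_eq_2:
  assumes "x \<in> carrier G" "x \<otimes> x = \<one>" "x \<noteq> \<one>"
  shows "ord x = 2"
proof -
  have "x [^] (2::nat) = \<one>" using assms by (simp add: numeral_2_eq_2)
  then have "ord x dvd 2" using assms(1) pow_eq_id by blast
  moreover have "ord x \<noteq> 1" using assms ord_eq_1 by blast
  ultimately show ?thesis by (metis One_nat_def dvd_imp_le le_antisym less_2_cases_iff
      linorder_not_less not_less_eq dvd_0_left_iff zero_neq_numeral pos2)
qed

lemma primitive_root_of_unity_power_eq_1_iff:
  assumes "primitive_root_of_unity n z"
  shows "z ^ m = 1 \<longleftrightarrow> n dvd m"
proof -
  have n: "n > 0" "z ^ n = 1" and least: "\<And>m. 0 < m \<Longrightarrow> m < n \<Longrightarrow> z ^ m \<noteq> 1"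
    using assms by (auto simp: primitive_root_of_unity_def)
  have "z ^ m = (z ^ n) ^ (m div n) * z ^ (m mod n)"
    by (simp flip: power_mult power_add)
  then have "z ^ m = z ^ (m mod n)" using n by simp
  moreover have "z ^ (m mod n) = 1 \<longleftrightarrow> m mod n = 0"
    using least[of "m mod n"] n(1) by (cases "m mod n = 0") auto
  ultimately show ?thesis by (simp add: mod_eq_0_iff_dvd)
qed

lemma primitive_root_of_unity_minus_inverse:
  assumes "primitive_root_of_unity (2 * k) z" "k \<ge> 2"
  shows "z \<noteq> 0" "z - inverse z \<noteq> 0"
proof -
  show z0: "z \<noteq> 0" using assms by (auto simp: primitive_root_of_unity_def power_0_left)
  have "z ^ 2 \<noteq> 1"
    using primitive_root_of_unity_power_eq_1_iff[OF assms(1), of 2] assms(2) by (auto dest: dvd_imp_le)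
  then show "z - inverse z \<noteq> 0" using z0 by (auto simp: field_simps power2_eq_square)
qed

text \<open>With \<open>U n = (z ^ n - z ^ (- n)) / (z - z ^ (- 1))\<close>, Cayley-Hamilton gives
  \<open>A ^ (n + 1) = U (n + 1) A - U n\<close> for a matrix \<open>A\<close> with eigenvalues \<open>z\<close> and \<open>1 / z\<close>.\<close>

lemma ord_proj_class:
  fixes A :: "'a::field^2^2"
  assumes tr: "trace A = z + inverse z" and det: "det A = 1" and ns: "\<not> A \<sim> mat 1"
    and z: "primitive_root_of_unity (2 * k) z" and k: "k \<ge> 2"
  shows "group.ord (PGL2 UNIV) (proj_class A) = k"
proof -
  interpret K: group "PGL2 (UNIV :: 'a set)" by (rule group_PGL2_UNIV)
  have carr: "proj_class A \<in> carrier (PGL2 UNIV)" using det by (simp add: carrier_PGL2_UNIV)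
  obtain a b c d where A: "A = mat2 a b c d" by (rule mat2_cases)
  note z0 = primitive_root_of_unity_minus_inverse(1)[OF z k]
    and w0 = primitive_root_of_unity_minus_inverse(2)[OF z k]
  define U where "U n = (z ^ n - inverse z ^ n) / (z - inverse z)" for n
  have Uw: "U n * (z - inverse z) = z ^ n - inverse z ^ n" for n using w0 by (simp add: U_def)
  have U0: "U 0 = 0" and U1: "U 1 = 1" using w0 by (auto simp: U_def)
  have U_Suc: "U (Suc (Suc n)) = (a + d) * U (Suc n) - U n" for n
  proof -
    have "z ^ Suc (Suc n) - inverse z ^ Suc (Suc n) =
        (z + inverse z) * (z ^ Suc n - inverse z ^ Suc n) - (z ^ n - inverse z ^ n)"
      using z0 by (simp add: field_simps)
    moreover have "a + d = z + inverse z" using tr by (simp add: A)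
    ultimately have "U (Suc (Suc n)) * (z - inverse z) = ((a + d) * U (Suc n) - U n) * (z - inverse z)"
      by (simp only: left_diff_distrib mult.assoc Uw)
    then show ?thesis by (rule mult_right_cancel[OF w0, THEN iffD1])
  qed
  \<comment> \<open>The induction carries the determinant along, as products and equality of classes
    are computed for invertible matrices.\<close>
  have pow: "proj_class A [^]\<^bsub>PGL2 UNIV\<^esub> Suc n =
      proj_class (mat2 (U (Suc n) * a - U n) (U (Suc n) * b) (U (Suc n) * c) (U (Suc n) * d - U n))
    \<and> det (mat2 (U (Suc n) * a - U n) (U (Suc n) * b) (U (Suc n) * c) (U (Suc n) * d - U n)) = 1" for n
  proof (induction n)
    case 0
    show ?case using carr det U1 by (simp add: A U0)
  next
    case (Suc n)
    let ?M = "\<lambda>n. mat2 (U (Suc n) * a - U n) (U (Suc n) * b) (U (Suc n) * c) (U (Suc n) * d - U n)"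
    have ad: "a * d = 1 + b * c" using det by (simp add: A algebra_simps)
    have ad': "a * (d * u) = u + b * (c * u)" for u
      by (simp only: ad distrib_right mult_1 flip: mult.assoc)
    have M: "?M n ** A = ?M (Suc n)"
      by (simp add: A U_Suc algebra_simps ad')
    have "proj_class A [^]\<^bsub>PGL2 UNIV\<^esub> Suc (Suc n) = proj_class (?M n) \<otimes>\<^bsub>PGL2 UNIV\<^esub> proj_class A"
      using Suc by simp
    also have "\<dots> = proj_class (?M (Suc n))"
      unfolding M[symmetric] using Suc det by (intro proj_class_mult) simp_all
    finally show ?case using Suc det by (metis M det_mul mult.right_neutral)
  qed
  have "proj_class A [^]\<^bsub>PGL2 UNIV\<^esub> m = \<one>\<^bsub>PGL2 UNIV\<^esub> \<longleftrightarrow> k dvd m" for m :: nat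
  proof (cases m)
    case 0
    then show ?thesis by simp
  next
    case (Suc n)
    let ?M = "mat2 (U (Suc n) * a - U n) (U (Suc n) * b) (U (Suc n) * c) (U (Suc n) * d - U n)"
    have "proj_class A [^]\<^bsub>PGL2 UNIV\<^esub> m = \<one>\<^bsub>PGL2 UNIV\<^esub> \<longleftrightarrow> ?M \<sim> mat 1"
      using pow[of n] by (simp only: Suc one_PGL2_UNIV) (subst proj_class_eq_iff; simp)
    \<comment> \<open>The off-diagonal entries and the difference of the diagonal ones are
      \<open>U m\<close> times those of the non-scalar \<open>A\<close>. Conversely, determinant
      \<open>1\<close> keeps the resulting scalar nonzero.\<close>
    also have "\<dots> \<longleftrightarrow> U m = 0"
    proof
      assume "?M \<sim> mat 1"
      then have "U m * a = U m * d" "U m * b = 0" "U m * c = 0" by (auto simp: mat2_prop2_1_iff Suc)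
      moreover have "\<not> (a = d \<and> b = 0 \<and> c = 0)" using ns det by (auto simp: A mat2_prop2_1_iff)
      ultimately show "U m = 0" by auto
    next
      assume "U m = 0"
      then show "?M \<sim> mat 1" using pow[of n] by (auto simp: mat2_prop2_1_iff Suc)
    qed
    \<comment> \<open>The doubled exponent is why a primitive \<open>2 * k\<close>-th root gives
      projective order \<open>k\<close>.\<close>
    also have "\<dots> \<longleftrightarrow> z ^ (2 * m) = 1"
    proof -
      have "U m = 0 \<longleftrightarrow> z ^ m = inverse (z ^ m)" using w0 by (simp add: U_def power_inverse)
      also have "\<dots> \<longleftrightarrow> z ^ m * z ^ m = 1" using z0 by (auto simp: field_simps)
      finally show ?thesis by (simp add: mult_2 power_add)
    qed
    also have "\<dots> \<longleftrightarrow> k dvd m" by (simp add: primitive_root_of_unity_power_eq_1_iff[OF z])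
    finally show ?thesis .
  qed
  then show ?thesis by (simp add: K.ord_unique[OF carr])
qed

text \<open>With trace zero, Cayley-Hamilton gives \<open>A ** A = mat (- det A)\<close>, which is
  trivial in the projective group.\<close>

lemma ord_proj_class_2:
  fixes A :: "'a::field^2^2"
  assumes "trace A = 0" "det A \<noteq> 0" "\<not> A \<sim> mat 1"
  shows "group.ord (PGL2 UNIV) (proj_class A) = 2"
proof -
  interpret K: group "PGL2 (UNIV :: 'a set)" by (rule group_PGL2_UNIV)
  obtain a b c d where A: "A = mat2 a b c d" by (rule mat2_cases)
  have d: "d = - a" using assms(1) by (simp add: A add_eq_0_iff)
  have "A ** A \<sim> mat 1" using assms(2) by (auto simp: A d mat2_prop2_1_iff algebra_simps add_eq_0_iff)
  then show ?thesis using assms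
    by (intro K.ord_eq_2)
       (auto simp: carrier_PGL2_UNIV proj_class_mult one_PGL2_UNIV proj_class_eq_iff det_mul)
qed

section \<open>Generated subgroups: orders and exchange of generators\<close>

lemma (in group) ord_subgroup_generated:
  assumes "x \<in> carrier (subgroup_generated G S)"
  shows "group.ord (subgroup_generated G S) x = ord x"
proof -
  interpret S: group "subgroup_generated G S" by simp
  have "x \<in> carrier G" using assms carrier_subgroup_generated_subset by blast
  then show ?thesis
    by (simp add: S.ord_unique[OF assms] pow_subgroup_generated pow_eq_id)
qed

text \<open>\<open>f\<close> permutes the generators, so it maps the generated subgroup onto itself;
  its square fixes the generators, hence everything they generate, which also gives
  injectivity.\<close>

lemma (in group) swap_generators_iso:
  assumes f: "f \<in> hom G G" and carr: "X \<in> carrier G" "Y \<in> carrier G" "Z \<in> carrier G"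
    and swap: "f X = Y" "f Y = X" "f Z = Z"
  shows "f \<in> iso (subgroup_generated G {X, Y, Z}) (subgroup_generated G {X, Y, Z})"
    and "\<And>g. g \<in> carrier (subgroup_generated G {X, Y, Z}) \<Longrightarrow> f (f g) = g"
proof -
  interpret f: group_hom G G f
    using f by (simp add: group_hom_def group_hom_axioms_def is_group)
  let ?H = "generate G {X, Y, Z}"
  have sub: "{X, Y, Z} \<subseteq> carrier G" using carr by simp
  have H: "carrier (subgroup_generated G {X, Y, Z}) = ?H"
    using sub by (simp add: carrier_subgroup_generated Int_absorb1)
  have HG: "g \<in> carrier G" if "g \<in> ?H" for g using generate_in_carrier[OF sub that] .
  have "f ` ?H = generate G (f ` {X, Y, Z})" by (rule f.generate_img[OF sub, symmetric])
  also have "f ` {X, Y, Z} = {X, Y, Z}" using swap by auto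
  finally have fH: "f ` ?H = ?H" .
  have ff: "f (f g) = g" if "g \<in> ?H" for g
    using that
  proof induction
    case (inv h)
    then have "h \<in> carrier G" using carr by auto
    then show ?case using inv swap by auto
  next
    case (eng g h)
    then show ?case using HG by simp
  qed (use swap in auto)
  then show "\<And>g. g \<in> carrier (subgroup_generated G {X, Y, Z}) \<Longrightarrow> f (f g) = g" using H by simp
  have "inj_on f ?H" by (rule inj_onI) (metis ff)
  then show "f \<in> iso (subgroup_generated G {X, Y, Z}) (subgroup_generated G {X, Y, Z})"
    using fH HG by (auto simp: iso_iff hom_def H)
qed

subsection \<open>The Frobenius twist of a generating triple\<close>

definition triple_X where "triple_X D \<omega> \<xi> = mat2 D (D * \<omega> * \<xi>) (- \<omega> * inverse \<xi>) (- D)"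
definition triple_Y where "triple_Y D \<xi> = mat2 0 (\<xi> * D) (inverse \<xi>) 0"
definition triple_Z where "triple_Z D = mat2 0 D 1 0"

text \<open>The matrix \<open>P\<close> commutes with \<open>Z\<close>; its ratio of entries is forced by \<open>P Y' \<sim> X P\<close>.\<close>

lemma ex_intertwiner_signed:
  fixes \<xi> x D \<omega> \<omega>' \<epsilon> :: "'a::field"
  assumes nz: "\<xi> \<noteq> 0" "x \<noteq> 0" "D \<noteq> 0" "\<xi> - inverse \<xi> \<noteq> 0" "x - inverse x \<noteq> 0"
    and \<epsilon>: "\<epsilon> = 1 \<or> \<epsilon> = -1"
    and \<omega>: "\<omega> = \<epsilon> * (x + inverse x)" and \<omega>': "\<omega>' = - \<epsilon> * (\<xi> + inverse \<xi>)"
    and D: "D = \<omega>'\<^sup>2 + \<omega>\<^sup>2 - 4"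
  shows "\<exists>P. det P \<noteq> 0 \<and> conj2 P (triple_Y D x) \<sim> triple_X D \<omega> \<xi> \<and>
    conj2 P (triple_X D \<omega>' x) \<sim> triple_Y D \<xi> \<and> conj2 P (triple_Z D) \<sim> triple_Z D"
proof -
  obtain \<xi>' where \<xi>': "inverse \<xi> = \<xi>'" "\<xi> * \<xi>' = 1" using nz by simp
  obtain x' where x': "inverse x = x'" "x * x' = 1" using nz by simp
  have \<epsilon>2: "\<epsilon> * \<epsilon> = 1" using \<epsilon> by auto
  \<comment> \<open>\<open>D\<close> factors as \<open>b * (\<xi>' * x + x' * \<xi>)\<close>, so
    \<open>D \<noteq> 0\<close> forces \<open>b \<noteq> 0\<close>. With
    \<open>a = - \<epsilon> * b\<close>, \<open>det P\<close> is \<open>b * b - D\<close>, which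
    then also splits into nonzero factors.\<close>
  define b where "b = \<xi> * x + \<xi>' * x'"
  define a where "a = - \<epsilon> * b"
  define P where "P = mat2 a D 1 a"
  have "D = (\<epsilon> * \<epsilon>) * (\<xi> + \<xi>')\<^sup>2 + (\<epsilon> * \<epsilon>) * (x + x')\<^sup>2 - 4"
    unfolding D \<omega> \<omega>' \<xi>'(1) x'(1) by (simp add: power2_eq_square algebra_simps)
  also have "(\<xi> + \<xi>')\<^sup>2 = \<xi> * \<xi> + \<xi>' * \<xi>' + 2 * (\<xi> * \<xi>')"
    by (simp add: power2_eq_square algebra_simps)
  also have "(x + x')\<^sup>2 = x * x + x' * x' + 2 * (x * x')"
    by (simp add: power2_eq_square algebra_simps)
  finally have "D = x * x + \<xi> * \<xi> + \<xi>' * \<xi>' + x' * x'"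
    by (simp add: \<epsilon>2 \<xi>' x')
  also have "\<dots> = (\<xi> * \<xi>') * (x * x) + (x * x') * (\<xi> * \<xi>) + (x * x') * (\<xi>' * \<xi>') + (\<xi> * \<xi>') * (x' * x')"
    by (simp add: \<xi>' x')
  also have "\<dots> = b * (\<xi>' * x + x' * \<xi>)"
    by (simp add: b_def algebra_simps)
  finally have D1: "D = b * (\<xi>' * x + x' * \<xi>)" .
  have "det P = (\<epsilon> * \<epsilon>) * (b * b) - D"
    by (simp add: P_def a_def)
  also have "\<dots> = b * (\<xi> - \<xi>') * (x - x')"
    unfolding \<epsilon>2 D1 by (simp add: b_def algebra_simps)
  finally have detP: "det P = b * (\<xi> - \<xi>') * (x - x')" .
  have "b \<noteq> 0" using D1 nz by auto
  then have P0: "det P \<noteq> 0" using detP nz unfolding \<xi>'(1) x'(1) by simp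
  \<comment> \<open>The scalar \<open>\<epsilon> * (\<xi> - \<xi>')\<close> is forced by comparing
    the lower right entries.\<close>
  have "mat (\<epsilon> * (\<xi> - \<xi>')) ** (P ** triple_Y D x) = triple_X D \<omega> \<xi> ** P"
    unfolding P_def triple_X_def triple_Y_def \<xi>'(1) x'(1) mat2_mult mat_mult_mat2 mat2_inject
  proof (intro conjI)
    show "\<epsilon> * (\<xi> - \<xi>') * (a * 0 + D * x') = D * a + D * \<omega> * \<xi> * 1"
      using \<epsilon> by (elim disjE) (simp_all add: a_def D1 b_def \<omega> x'(1) algebra_simps)
    show "\<epsilon> * (\<xi> - \<xi>') * (a * (x * D) + D * 0) = D * D + D * \<omega> * \<xi> * a"
      using \<epsilon> by (elim disjE) (simp_all add: a_def D1 b_def \<omega> x'(1) algebra_simps)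
    show "\<epsilon> * (\<xi> - \<xi>') * (1 * 0 + a * x') = - \<omega> * \<xi>' * a + - D * 1"
      using \<epsilon> by (elim disjE) (simp_all add: a_def D1 b_def \<omega> x'(1) algebra_simps)
    show "\<epsilon> * (\<xi> - \<xi>') * (1 * (x * D) + a * 0) = - \<omega> * \<xi>' * D + - D * a"
      using \<epsilon> by (elim disjE) (simp_all add: a_def D1 b_def \<omega> x'(1) algebra_simps)
  qed
  then have 1: "conj2 P (triple_Y D x) \<sim> triple_X D \<omega> \<xi>"
    using nz \<epsilon>2 by (intro conj2_prop2I[OF P0]) (metis \<xi>'(1) mult_eq_0_iff prop2_mat_left prop2_refl zero_neq_one)
  have "P ** triple_X D \<omega>' x = mat (- \<epsilon> * (x - x')) ** (triple_Y D \<xi> ** P)"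
    unfolding P_def triple_X_def triple_Y_def \<xi>'(1) x'(1) mat2_mult mat_mult_mat2 mat2_inject
  proof (intro conjI)
    show "a * D + D * (- \<omega>' * x') = - \<epsilon> * (x - x') * (0 * a + \<xi> * D * 1)"
      using \<epsilon> by (elim disjE) (simp_all add: a_def D1 b_def \<omega>' \<xi>'(1) algebra_simps)
    show "a * (D * \<omega>' * x) + D * - D = - \<epsilon> * (x - x') * (0 * D + \<xi> * D * a)"
      using \<epsilon> by (elim disjE) (simp_all add: a_def D1 b_def \<omega>' \<xi>'(1) algebra_simps)
    show "1 * D + a * (- \<omega>' * x') = - \<epsilon> * (x - x') * (\<xi>' * a + 0 * 1)"
      using \<epsilon> by (elim disjE) (simp_all add: a_def D1 b_def \<omega>' \<xi>'(1) algebra_simps)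
    show "1 * (D * \<omega>' * x) + a * - D = - \<epsilon> * (x - x') * (\<xi>' * D + 0 * a)"
      using \<epsilon> by (elim disjE) (simp_all add: a_def D1 b_def \<omega>' \<xi>'(1) algebra_simps)
  qed
  then have 2: "conj2 P (triple_X D \<omega>' x) \<sim> triple_Y D \<xi>"
    using nz \<epsilon>2 by (intro conj2_prop2I[OF P0])
      (metis x'(1) mult_eq_0_iff prop2_mat neg_equal_0_iff_equal zero_neq_one)
  have 3: "conj2 P (triple_Z D) \<sim> triple_Z D"
    by (intro conj2_prop2I[OF P0]) (simp add: P_def triple_Z_def mult.commute)
  show ?thesis using P0 1 2 3 by blast
qed

lemma ex_intertwiner:
  fixes \<xi> x D \<omega> \<omega>' :: "'a::field"
  assumes nz: "\<xi> \<noteq> 0" "x \<noteq> 0" "D \<noteq> 0" "\<xi> - inverse \<xi> \<noteq> 0" "x - inverse x \<noteq> 0"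
    and \<omega>: "\<omega>\<^sup>2 = (x + inverse x)\<^sup>2" and \<omega>': "\<omega>'\<^sup>2 = (\<xi> + inverse \<xi>)\<^sup>2"
    and D: "D = \<omega>'\<^sup>2 + \<omega>\<^sup>2 - 4"
  shows "\<exists>P. det P \<noteq> 0 \<and> conj2 P (triple_Y D x) \<sim> triple_X D \<omega> \<xi> \<and>
    conj2 P (triple_X D \<omega>' x) \<sim> triple_Y D \<xi> \<and> conj2 P (triple_Z D) \<sim> triple_Z D"
proof -
  obtain \<epsilon> where \<epsilon>: "\<epsilon> = 1 \<or> \<epsilon> = -1" "\<omega> = \<epsilon> * (x + inverse x)"
    using \<omega> unfolding power2_eq_iff by (metis mult_1 mult_minus1)
  have "\<omega>' = - \<epsilon> * (\<xi> + inverse \<xi>) \<or> - \<omega>' = - \<epsilon> * (\<xi> + inverse \<xi>)"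
    using \<omega>' \<epsilon>(1) unfolding power2_eq_iff by auto
  then show ?thesis
  proof
    assume "\<omega>' = - \<epsilon> * (\<xi> + inverse \<xi>)"
    then show ?thesis using ex_intertwiner_signed[OF nz \<epsilon> _ D] by blast
  next
    assume *: "- \<omega>' = - \<epsilon> * (\<xi> + inverse \<xi>)"
    have "D = (- \<omega>')\<^sup>2 + \<omega>\<^sup>2 - 4" using D by simp
    from ex_intertwiner_signed[OF nz \<epsilon> * this] obtain P where P: "det P \<noteq> 0"
      "conj2 P (triple_Y D x) \<sim> triple_X D \<omega> \<xi>"
      "conj2 P (triple_X D (- \<omega>') x) \<sim> triple_Y D \<xi>" "conj2 P (triple_Z D) \<sim> triple_Z D"
      by blast
    \<comment> \<open>The signs of \<open>\<omega>\<close> and \<open>\<omega>'\<close> are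
      independent here. Conjugation by \<open>J\<close> reverses that of \<open>\<omega>'\<close> up
      to a scalar and preserves the other two generators, which reduces to the correlated
      signs.\<close>
    define J :: "'a^2^2" where "J = mat2 1 0 0 (-1)"
    have "conj2 J (triple_X D \<omega>' x) = mat (-1) ** triple_X D (- \<omega>') x"
      by (simp add: J_def conj2_def triple_X_def)
    then have "conj2 J (triple_X D \<omega>' x) \<sim> triple_X D (- \<omega>') x" by simp
    then have "conj2 P (conj2 J (triple_X D \<omega>' x)) \<sim> triple_Y D \<xi>"
      using P(3) conj2_prop2 prop2_trans by blast
    moreover have "conj2 J (triple_Y D x) = triple_Y D x" "conj2 J (triple_Z D) = triple_Z D"
      by (simp_all add: J_def conj2_def triple_Y_def triple_Z_def)
    moreover have "det (P ** J) \<noteq> 0" using P(1) by (simp add: det_mul J_def)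
    ultimately show ?thesis using P by (metis conj2_conj2)
  qed
qed

lemma proj_class_scale:
  "c \<noteq> 0 \<Longrightarrow> det A \<noteq> 0 \<Longrightarrow> proj_class (mat c ** A) = proj_class A"
  by (subst proj_class_eq_iff) (simp_all add: det_mul)

section \<open>Semilinear maps of \<open>PGL(2, K)\<close>\<close>

context finite_subfield
begin

definition frobm :: "nat \<Rightarrow> 'a^2^2 \<Rightarrow> 'a^2^2" where
  "frobm j A = mat2 (A$1$1 ^ p ^ j) (A$1$2 ^ p ^ j) (A$2$1 ^ p ^ j) (A$2$2 ^ p ^ j)"

lemma frobm_mat2: "frobm j (mat2 a b c d) = mat2 (a ^ p ^ j) (b ^ p ^ j) (c ^ p ^ j) (d ^ p ^ j)"
  by (simp add: frobm_def)

lemma frobm_mult: "frobm j (A ** B) = frobm j A ** frobm j B"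
  by (cases A rule: mat2_cases; cases B rule: mat2_cases)
     (simp add: frobm_mat2 frob_add power_mult_distrib)

lemma det_frobm: "det (frobm j A) = det A ^ p ^ j"
  by (cases A rule: mat2_cases) (simp add: frobm_mat2 frob_diff power_mult_distrib)

lemma frobm_prop2:
  assumes "A \<sim> B"
  shows "frobm j A \<sim> frobm j B"
proof -
  obtain s where "s \<noteq> 0" "A = mat s ** B" using assms by (auto simp: prop2_def)
  moreover obtain a b c d where "B = mat2 a b c d" by (rule mat2_cases)
  ultimately show ?thesis
    unfolding prop2_def by (intro exI[of _ "s ^ p ^ j"]) (simp add: frobm_mat2 power_mult_distrib)
qed

text \<open>The action of an element of \<open>PGammaL(2, K)\<close>: Frobenius on entries, then
  conjugation by \<open>P\<close>. By \<open>twist_proj_class\<close> the representative does not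
  matter.\<close>

definition twist :: "'a^2^2 \<Rightarrow> nat \<Rightarrow> ('a^2^2) set \<Rightarrow> ('a^2^2) set" where
  "twist P j g = proj_class (conj2 P (frobm j (repr g)))"

lemma det_twist: "det P \<noteq> 0 \<Longrightarrow> det A \<noteq> 0 \<Longrightarrow> det (conj2 P (frobm j A)) \<noteq> 0"
  by (simp add: det_conj2 det_frobm)

lemma twist_proj_class:
  assumes "det P \<noteq> 0" "det A \<noteq> 0"
  shows "twist P j (proj_class A) = proj_class (conj2 P (frobm j A))"
proof -
  have "det (repr (proj_class A)) \<noteq> 0" using assms repr(1) by (auto simp: carrier_PGL2_UNIV)
  then show ?thesis unfolding twist_def using assms repr_proj_class[of A]
    by (simp add: proj_class_eq_iff det_twist conj2_prop2 frobm_prop2)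
qed

lemma twist_hom:
  assumes P: "det P \<noteq> 0"
  shows "twist P j \<in> hom (PGL2 UNIV) (PGL2 UNIV)"
proof (rule homI)
  show "twist P j g \<in> carrier (PGL2 UNIV)" if "g \<in> carrier (PGL2 UNIV)" for g
    unfolding twist_def using det_twist[OF P repr(1)[OF that]] by (auto simp: carrier_PGL2_UNIV)
  fix g h assume "g \<in> carrier (PGL2 (UNIV :: 'a set))" "h \<in> carrier (PGL2 (UNIV :: 'a set))"
  then obtain A B :: "'a^2^2" where A: "det A \<noteq> 0" "g = proj_class A" and B: "det B \<noteq> 0" "h = proj_class B"
    by (auto simp: carrier_PGL2_UNIV)
  have "twist P j (g \<otimes>\<^bsub>PGL2 UNIV\<^esub> h) = proj_class (conj2 P (frobm j A ** frobm j B))"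
    using A B P by (simp add: proj_class_mult twist_proj_class det_mul frobm_mult)
  \<comment> \<open>The factor \<open>det P\<close> is inserted because \<open>conj2\<close> is
    multiplicative only up to that scalar.\<close>
  also have "\<dots> = proj_class (mat (det P) ** conj2 P (frobm j A ** frobm j B))"
    using A B P by (intro proj_class_scale[symmetric]) (simp_all add: det_conj2 det_mul det_frobm)
  also have "\<dots> = twist P j g \<otimes>\<^bsub>PGL2 UNIV\<^esub> twist P j h"
    using A B P by (simp add: twist_proj_class proj_class_mult det_twist conj2_mult)
  finally show "twist P j (g \<otimes>\<^bsub>PGL2 UNIV\<^esub> h) = twist P j g \<otimes>\<^bsub>PGL2 UNIV\<^esub> twist P j h" .
qed

lemma frob_two: "(2::'a) ^ p ^ j = 2"
  using frob_add[of 1 1 j] by simp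

lemma frob_four: "(4::'a) ^ p ^ j = 4"
proof -
  have "(4::'a) ^ p ^ j = (2 * 2) ^ p ^ j" by simp
  then show ?thesis by (simp only: power_mult_distrib frob_two) simp
qed

end

text \<open>Here \<open>\<xi>\<close> is \<open>\<xi>\<^sub>\<kappa>\<close> and \<open>\<omega>\<close> is \<open>\<omega>\<^sub>\<lambda>\<close>.\<close>

locale triple = finite_subfield p q e F for p q e and F :: "'a::alg_closed_field set" +
  fixes \<xi> \<omega> D :: 'a
  assumes \<xi>0: "\<xi> \<noteq> 0" and w0: "\<xi> - inverse \<xi> \<noteq> 0" and D0: "D \<noteq> 0"
    and D_def: "D = (\<xi> + inverse \<xi>)\<^sup>2 + \<omega>\<^sup>2 - 4"
begin

abbreviation "x \<equiv> triple_X D \<omega> \<xi>"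
abbreviation "y \<equiv> triple_Y D \<xi>"
abbreviation "z \<equiv> triple_Z D"
abbreviation "X \<equiv> proj_class x"
abbreviation "Y \<equiv> proj_class y"
abbreviation "Z \<equiv> proj_class z"
abbreviation "K \<equiv> PGL2 (UNIV :: 'a set)"

sublocale K: group K by (rule group_PGL2_UNIV)

text \<open>This identity makes \<open>det x\<close> equal to \<open>- D\<close> times a nonzero
  square, so \<open>x\<close> is invertible.\<close>

lemma D_minus: "D - \<omega>\<^sup>2 = (\<xi> - inverse \<xi>)\<^sup>2"
  using \<xi>0 by (simp add: D_def power2_eq_square field_simps)

lemma det_x: "det x = - D * (\<xi> - inverse \<xi>)\<^sup>2"
  using \<xi>0 unfolding D_minus[symmetric] by (simp add: triple_X_def power2_eq_square algebra_simps)

lemma det_y: "det y = - D" and det_z: "det z = - D"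
  using \<xi>0 by (simp_all add: triple_Y_def triple_Z_def)

lemma dets [simp]: "det x \<noteq> 0" "det y \<noteq> 0" "det z \<noteq> 0"
  using det_x det_y det_z D0 w0 by simp_all

lemma carriers [simp]: "X \<in> carrier K" "Y \<in> carrier K" "Z \<in> carrier K"
  by (auto simp: carrier_PGL2_UNIV)

lemma theta_yz: "theta (y ** z) = (\<xi> + inverse \<xi>)\<^sup>2"
proof -
  have "y ** z = mat D ** mat2 \<xi> 0 0 (inverse \<xi>)"
    by (simp add: triple_Y_def triple_Z_def mult.commute)
  then have "theta (y ** z) = theta (mat2 \<xi> 0 0 (inverse \<xi>))"
    using D0 by (simp only:) (rule theta_prop2, simp del: mat_mult_mat2)
  then show ?thesis using \<xi>0 by (simp add: theta_mat2)
qed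

lemma trace_xz: "trace (x ** z) = D * \<omega> * (\<xi> - inverse \<xi>)"
  and trace_zx: "trace (z ** x) = D * \<omega> * (\<xi> - inverse \<xi>)"
  by (simp_all add: triple_X_def triple_Z_def algebra_simps)

lemma det_xz: "det (x ** z) = (D * (\<xi> - inverse \<xi>))\<^sup>2"
  and det_zx: "det (z ** x) = (D * (\<xi> - inverse \<xi>))\<^sup>2"
  unfolding det_mul det_x det_z by (simp_all add: power2_eq_square)

lemma theta_xz: "theta (x ** z) = \<omega>\<^sup>2"
  using w0 D0 by (simp add: theta_def trace_xz det_xz power_mult_distrib)

lemma regular_map_triple:
  assumes \<xi>: "primitive_root_of_unity (2 * k) \<xi>"
    and \<zeta>: "primitive_root_of_unity (2 * l) \<zeta>" "\<omega> = \<zeta> + inverse \<zeta>"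
    and kl: "k \<ge> 2" "l \<ge> 2"
  shows "regular_map k l (subgroup_generated K {X, Y, Z}) X Y Z"
proof -
  let ?G = "subgroup_generated K {X, Y, Z}"
  have sub: "{X, Y, Z} \<subseteq> carrier K" by simp
  have H: "carrier ?G = generate K {X, Y, Z}"
    using sub by (simp add: carrier_subgroup_generated Int_absorb1)
  have inG: "X \<in> carrier ?G" "Y \<in> carrier ?G" "Z \<in> carrier ?G"
    unfolding H by (auto intro: generate.incl)
  have gen: "generate ?G {X, Y, Z} = carrier ?G"
  proof -
    have "generate ?G (carrier ?G \<inter> {X, Y, Z}) = carrier (subgroup_generated ?G {X, Y, Z})"
      by (rule carrier_subgroup_generated[symmetric])
    moreover have "carrier ?G \<inter> {X, Y, Z} = {X, Y, Z}" using inG by auto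
    ultimately show ?thesis by simp
  qed
  have group: "group ?G" by simp
  then interpret G: group ?G .
  have ord: "group.ord ?G g = K.ord g" if "g \<in> carrier ?G" for g
    using that by (rule K.ord_subgroup_generated)
  have mult: "X \<otimes>\<^bsub>K\<^esub> Y = proj_class (x ** y)" "Y \<otimes>\<^bsub>K\<^esub> Z = proj_class (y ** z)"
    "Z \<otimes>\<^bsub>K\<^esub> X = proj_class (z ** x)"
    by (simp_all add: proj_class_mult)
  have prods: "X \<otimes>\<^bsub>K\<^esub> Y \<in> carrier ?G" "Y \<otimes>\<^bsub>K\<^esub> Z \<in> carrier ?G" "Z \<otimes>\<^bsub>K\<^esub> X \<in> carrier ?G"
    using G.m_closed inG by auto
  \<comment> \<open>Odd characteristic enters here: the diagonal entries of \<open>x\<close> differ,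
    so \<open>x\<close> is not scalar.\<close>
  have "D \<noteq> - D"
  proof
    assume "D = - D"
    then have "D + D = 0" by (simp add: eq_neg_iff_add_eq_0)
    then have "2 * D = 0" by (simp only: mult_2)
    then show False using D0 by simp
  qed
  then have oX: "K.ord X = 2"
    by (intro ord_proj_class_2) (simp_all, simp_all add: triple_X_def mat2_prop2_1_iff)
  have oY: "K.ord Y = 2"
    using \<xi>0 D0 by (intro ord_proj_class_2) (simp_all, simp_all add: triple_Y_def mat2_prop2_1_iff)
  have oZ: "K.ord Z = 2"
    by (intro ord_proj_class_2) (simp_all, simp_all add: triple_Z_def mat2_prop2_1_iff)
  have oXY: "K.ord (X \<otimes>\<^bsub>K\<^esub> Y) = 2" unfolding mult
    using \<xi>0 D0 by (intro ord_proj_class_2)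
      (simp_all add: det_mul, simp_all add: triple_X_def triple_Y_def mat2_prop2_1_iff)
  have oYZ: "K.ord (Y \<otimes>\<^bsub>K\<^esub> Z) = k"
  proof -
    have "y ** z = mat D ** mat2 \<xi> 0 0 (inverse \<xi>)"
      by (simp add: triple_Y_def triple_Z_def mult.commute)
    then have "Y \<otimes>\<^bsub>K\<^esub> Z = proj_class (mat2 \<xi> 0 0 (inverse \<xi>))"
      unfolding mult using D0 \<xi>0 by (simp only:) (rule proj_class_scale, simp_all)
    moreover have "K.ord (proj_class (mat2 \<xi> 0 0 (inverse \<xi>))) = k"
      using w0 \<xi>0 by (intro ord_proj_class[OF _ _ _ \<xi> kl(1)]) (auto simp: mat2_prop2_1_iff)
    ultimately show ?thesis by simp
  qed
  have oZX: "K.ord (Z \<otimes>\<^bsub>K\<^esub> X) = l"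
  proof -
    \<comment> \<open>Dividing by \<open>c\<close>, a square root of \<open>det (z ** x)\<close>,
      gives determinant \<open>1\<close> and trace \<open>\<omega>\<close>, the form that
      \<open>ord_proj_class\<close> needs.\<close>
    define c where "c = D * (\<xi> - inverse \<xi>)"
    have c: "c \<noteq> 0" using D0 w0 by (simp add: c_def)
    define A where "A = mat (inverse c) ** (z ** x)"
    have A: "Z \<otimes>\<^bsub>K\<^esub> X = proj_class A"
      unfolding mult A_def using c by (intro proj_class_scale[symmetric]) (simp_all add: det_mul)
    have "det A = (inverse c * c) * (inverse c * c)"
      unfolding A_def det_mul[of "mat _"] det_zx c_def[symmetric] by (simp add: power2_eq_square)
    then have "det A = 1" using c by simp
    moreover have "trace A = inverse c * trace (z ** x)"
      by (cases "z ** x" rule: mat2_cases) (simp add: A_def distrib_left)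
    then have "trace A = (inverse c * c) * \<omega>"
      by (simp add: trace_zx c_def mult_ac)
    then have "trace A = \<zeta> + inverse \<zeta>" using c by (simp add: \<zeta>(2))
    moreover have "\<not> A \<sim> mat 1"
      unfolding A_def using c D0 by (simp add: triple_X_def triple_Z_def mat2_prop2_1_iff)
    ultimately show ?thesis unfolding A by (intro ord_proj_class[OF _ _ _ \<zeta>(1) kl(2)])
  qed
  show ?thesis unfolding regular_map_def
    using group inG gen prods oX oY oZ oXY oYZ oZX by (simp add: ord)
qed

text \<open>The hypotheses say that this power of Frobenius exchanges
  \<open>(\<xi> + inverse \<xi>)\<^sup>2\<close> and \<open>\<omega>\<^sup>2\<close>. Hence it fixes
  \<open>D\<close>, the twisted triple has the same shape, and \<open>ex_intertwiner\<close>
  conjugates it to the triple with \<open>X\<close> and \<open>Y\<close> exchanged.\<close>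

lemma self_dual_if_frob:
  assumes conj: "\<omega>\<^sup>2 = ((\<xi> + inverse \<xi>)\<^sup>2) ^ p ^ j" "(\<omega>\<^sup>2) ^ p ^ j = (\<xi> + inverse \<xi>)\<^sup>2"
    and reg: "regular_map k l (subgroup_generated K {X, Y, Z}) X Y Z"
  shows "self_dual_map k l (subgroup_generated K {X, Y, Z}) X Y Z"
proof -
  define r where "r = p ^ j"
  have sq: "(t ^ r)\<^sup>2 = (t\<^sup>2) ^ r" for t :: 'a by (metis power_mult mult.commute)
  define x' where "x' = \<xi> ^ r"
  have x'0: "x' \<noteq> 0" using \<xi>0 by (simp add: x'_def)
  have "x' - inverse x' = (\<xi> - inverse \<xi>) ^ r"
    by (simp add: x'_def r_def frob_diff power_inverse)
  then have x'w: "x' - inverse x' \<noteq> 0" using w0 by simp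
  have x's: "x' + inverse x' = (\<xi> + inverse \<xi>) ^ r"
    by (simp add: x'_def r_def frob_add power_inverse)
  have Dr: "D ^ r = D"
    using conj by (subst (1 2) D_def) (simp add: r_def frob_add frob_diff frob_four)
  have 1: "\<omega>\<^sup>2 = (x' + inverse x')\<^sup>2" unfolding x's sq using conj(1) unfolding r_def .
  have 2: "(\<omega> ^ r)\<^sup>2 = (\<xi> + inverse \<xi>)\<^sup>2" unfolding sq using conj(2) unfolding r_def .
  have 3: "D = (\<omega> ^ r)\<^sup>2 + \<omega>\<^sup>2 - 4" using D_def 2 by simp
  obtain P where P: "det P \<noteq> 0" "conj2 P (triple_Y D x') \<sim> x"
      "conj2 P (triple_X D (\<omega> ^ r) x') \<sim> y" "conj2 P z \<sim> z"
    using ex_intertwiner[OF \<xi>0 x'0 D0 w0 x'w 1 2 3] by blast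
  have p0: "p > 0" using p_gt_2 by linarith
  have fx: "frobm j x = triple_X D (\<omega> ^ r) x'"
    using Dr by (simp add: triple_X_def frobm_mat2 x'_def r_def frob_minus power_mult_distrib power_inverse)
  have fy: "frobm j y = triple_Y D x'"
    using Dr p0 by (simp add: triple_Y_def frobm_mat2 x'_def r_def power_mult_distrib power_inverse)
  have fz: "frobm j z = z"
    using Dr p0 by (simp add: triple_Z_def frobm_mat2 r_def)
  have swap: "twist P j X = Y" "twist P j Y = X" "twist P j Z = Z"
    using P det_twist[OF P(1), of x j] det_twist[OF P(1), of y j] det_twist[OF P(1), of z j]
    by (simp_all add: twist_proj_class proj_class_eq_iff fx fy fz)
  show ?thesis unfolding self_dual_map_def
    using reg K.swap_generators_iso[OF twist_hom[OF P(1)] carriers swap] swap by blast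
qed

end

section \<open>The criterion for self-duality\<close>

theorem theorem4p1:
  fixes p q e k l :: nat
    and \<xi>\<^sub>k \<xi>\<^sub>l \<omega>\<^sub>k \<omega>\<^sub>l D s \<beta> \<eta> :: "'a::alg_closed_field"
    and X Y Z :: "('a^2^2) set"
    and G :: "('a^2^2) set monoid"
  assumes "algebraic_closure_of_GF TYPE('a) p"
    and "prime p" and "odd p" and "e \<ge> 1" and "q = p ^ e"
    and "k \<ge> 3" and "coprime k p"
    and "1 / real k + 1 / real k < 1 / 2"
    and "l = k"
    and "primitive_root_of_unity (2 * k) \<xi>\<^sub>k" and "\<xi>\<^sub>k \<in> GF q \<union> GF (q ^ 2)"
    and "primitive_root_of_unity (2 * l) \<xi>\<^sub>l" and "\<xi>\<^sub>l \<in> GF q \<union> GF (q ^ 2)"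
    and "\<omega>\<^sub>k = \<xi>\<^sub>k + inverse \<xi>\<^sub>k" and "\<omega>\<^sub>l = \<xi>\<^sub>l + inverse \<xi>\<^sub>l"
    and "D = \<omega>\<^sub>k ^ 2 + \<omega>\<^sub>l ^ 2 - 4" and "D \<noteq> 0"
    and "s ^ 2 = - D" and "\<beta> = - 1 / s"
    and "\<eta> = inverse (\<xi>\<^sub>k - inverse \<xi>\<^sub>k)"
    and "X = proj_class (mat (\<eta> * \<beta>) **
               mat2 D (D * \<omega>\<^sub>l * \<xi>\<^sub>k) (- \<omega>\<^sub>l * inverse \<xi>\<^sub>k) (- D))"
    and "Y = proj_class (mat \<beta> ** mat2 0 (\<xi>\<^sub>k * D) (inverse \<xi>\<^sub>k) 0)"
    and "Z = proj_class (mat \<beta> ** mat2 0 D 1 0)"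
    and "G = subgroup_generated (PGL2 UNIV) {X, Y, Z}"
    and "G \<cong> PSL2 (GF q :: 'a set) \<or> G \<cong> PGL2 (GF q :: 'a set)"
  shows "self_dual_map k l G X Y Z \<longleftrightarrow>
         (\<exists>j::nat. (j = 0 \<or> 2 * j = e) \<and>
              (\<omega>\<^sub>l = \<omega>\<^sub>k ^ (p ^ j) \<or> \<omega>\<^sub>l = - (\<omega>\<^sub>k ^ (p ^ j))))"
proof -
  interpret finite_subfield p q e "GF q :: 'a set"
    using assms(1-5) by unfold_locales (auto simp: algebraic_closure_of_GF_def)
  have k2: "k \<ge> 2" and l2: "l \<ge> 2" using assms(6,9) by auto
  note \<xi>k = primitive_root_of_unity_minus_inverse[OF assms(10) k2]
  interpret T: triple p q e "GF q :: 'a set" \<xi>\<^sub>k \<omega>\<^sub>l D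
    using \<xi>k assms(14,16,17) by unfold_locales auto
  have "s \<noteq> 0" using assms(17,18) by auto
  then have \<beta>: "\<beta> \<noteq> 0" using assms(19) by simp
  have \<eta>: "\<eta> \<noteq> 0" using assms(20) \<xi>k(2) by simp
  have X: "X = T.X" unfolding assms(21) triple_X_def[symmetric]
    using \<beta> \<eta> by (intro proj_class_scale) auto
  have Y: "Y = T.Y" unfolding assms(22) triple_Y_def[symmetric]
    using \<beta> by (intro proj_class_scale) auto
  have Z: "Z = T.Z" unfolding assms(23) triple_Z_def[symmetric]
    using \<beta> by (intro proj_class_scale) auto
  let ?H = "generate T.K {T.X, T.Y, T.Z}"
  have sub: "{T.X, T.Y, T.Z} \<subseteq> carrier T.K" by simp
  have G: "G = T.K\<lparr>carrier := ?H\<rparr>"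
    unfolding assms(24) X Y Z subgroup_generated_def using sub by (simp add: Int_absorb1)
  have H: "subgroup ?H T.K" by (rule T.K.generate_is_subgroup[OF sub])
  \<comment> \<open>\<open>C\<close> is \<open>SL2\<close> or \<open>GL2\<close> over the subfield,
    so both possible isomorphism types of \<open>G\<close> continue as one case.\<close>
  obtain C where C: "linear_group p q e (GF q :: 'a set) C"
    and iso: "G \<cong> matrix_group.GC C Mod matrix_group.ZC C"
    using assms(25) linear_group_GL2 linear_group_SL2 unfolding matrix_group_F(3,4) by blast
  interpret L: linear_group p q e "GF q :: 'a set" C by (rule C)
  note iso = iso[unfolded G]
  have inH: "T.X \<in> ?H" "T.Y \<in> ?H" "T.Z \<in> ?H" by (auto intro: generate.incl)
  have YZ: "T.Y \<otimes>\<^bsub>T.K\<^esub> T.Z \<in> ?H" using inH by (intro generate.eng)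
  have theta_YZ: "theta (repr (T.Y \<otimes>\<^bsub>T.K\<^esub> T.Z)) = \<omega>\<^sub>k\<^sup>2"
    by (simp add: proj_class_mult theta_repr det_mul T.theta_yz assms(14))
  have theta_XZ: "theta (repr (T.X \<otimes>\<^bsub>T.K\<^esub> T.Z)) = \<omega>\<^sub>l\<^sup>2"
    by (simp add: proj_class_mult theta_repr det_mul T.theta_xz)
  have sq: "(t ^ p ^ j)\<^sup>2 = (t\<^sup>2) ^ p ^ j" for t :: 'a and j by (metis power_mult mult.commute)
  \<comment> \<open>The sign ambiguity in the criterion is that of a square root, so it can be
    stated for the invariants \<open>theta\<close>.\<close>
  have squares: "\<omega>\<^sub>l = \<omega>\<^sub>k ^ (p ^ j) \<or> \<omega>\<^sub>l = - (\<omega>\<^sub>k ^ (p ^ j)) \<longleftrightarrow> \<omega>\<^sub>l\<^sup>2 = (\<omega>\<^sub>k\<^sup>2) ^ p ^ j" for j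
    unfolding sq[symmetric] power2_eq_iff ..
  show ?thesis
  proof
    assume "self_dual_map k l G X Y Z"
    then obtain f where f: "f \<in> iso G G" "\<And>g. g \<in> ?H \<Longrightarrow> f (f g) = g"
      "f T.Z = T.Z" "f T.Y = T.X"
      by (auto simp: self_dual_map_def G X Y Z)
    obtain d where d: "d = 0 \<or> 2 * d = e"
      "\<And>g. g \<in> ?H \<Longrightarrow> theta (repr (f g)) = theta (repr g) ^ p ^ d"
      using L.theta_involutory_automorphism[OF H iso f(1)[unfolded G] f(2)] by blast
    have "f (T.Y \<otimes>\<^bsub>T.K\<^esub> T.Z) = T.X \<otimes>\<^bsub>T.K\<^esub> T.Z"
      using f(1,3,4) inH by (simp add: G iso_def hom_def)
    then have "\<omega>\<^sub>l\<^sup>2 = (\<omega>\<^sub>k\<^sup>2) ^ p ^ d" using d(2)[OF YZ] theta_YZ theta_XZ by simp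
    then show "\<exists>j. (j = 0 \<or> 2 * j = e) \<and> (\<omega>\<^sub>l = \<omega>\<^sub>k ^ p ^ j \<or> \<omega>\<^sub>l = - (\<omega>\<^sub>k ^ p ^ j))"
      using d(1) squares by blast
  next
    assume "\<exists>j. (j = 0 \<or> 2 * j = e) \<and> (\<omega>\<^sub>l = \<omega>\<^sub>k ^ p ^ j \<or> \<omega>\<^sub>l = - (\<omega>\<^sub>k ^ p ^ j))"
    then obtain j where j: "j = 0 \<or> 2 * j = e" "\<omega>\<^sub>l\<^sup>2 = (\<omega>\<^sub>k\<^sup>2) ^ p ^ j" using squares by blast
    \<comment> \<open>\<open>\<xi>\<^sub>k\<close> may lie only in the quadratic extension;
      membership of \<open>\<omega>\<^sub>k\<^sup>2\<close> comes from the isomorphism type of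
      \<open>G\<close>. It makes the \<open>q\<close>-th power trivial when
      \<open>2 * j = e\<close>, so Frobenius exchanges the two squares.\<close>
    have "\<omega>\<^sub>k\<^sup>2 \<in> GF q" using L.theta_subgroup_F[OF H iso YZ] theta_YZ by simp
    then have "(\<omega>\<^sub>k\<^sup>2) ^ q = \<omega>\<^sub>k\<^sup>2" by (simp only: F_iff)
    moreover have "(\<omega>\<^sub>l\<^sup>2) ^ p ^ j = (\<omega>\<^sub>k\<^sup>2) ^ p ^ (2 * j)"
      by (simp only: j(2) mult_2 power_add power_mult)
    ultimately have "(\<omega>\<^sub>l\<^sup>2) ^ p ^ j = \<omega>\<^sub>k\<^sup>2" using j(1) q_def by auto
    moreover have "regular_map k l (subgroup_generated T.K {T.X, T.Y, T.Z}) T.X T.Y T.Z"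
      using assms(10,12,15) k2 l2 by (rule T.regular_map_triple)
    ultimately have "self_dual_map k l (subgroup_generated T.K {T.X, T.Y, T.Z}) T.X T.Y T.Z"
      using j(2) unfolding assms(14) by (intro T.self_dual_if_frob)
    then show "self_dual_map k l G X Y Z" by (simp only: assms(24) X Y Z)
  qed
qed

end
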